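(* Let $n\ge 2$, let $W=\mathbb{C}^{n^2}$ be identified with the space of $n\times n$ complex matrices, let $Q(A)=\mathrm{trace}(AA^T)$, and let $O(W,Q)\subset GL(W)$ be the orthogonal group of $Q$. Let $P\in S^nW$ be nonzero with $[P]\in \overline{O(W,Q)\cdot [\det_n]}\subset \mathbb{P}S^nW$ (Zariski closure). Then $P$ divides $\mathrm{trace}(H(P)^{\wedge j})\in S^{j(n-2)}W$ for each odd $j$ with $1<j\le 2n+1$. In particular, for each such $j$ one obtains a nonzero $O(W,Q)$-module of homogeneous polynomials of degree $(j-1)(n-1)$ on $S^nW$ vanishing on $\overline{O(W,Q)\cdot[\det_n]}$.
   Context: $\det_n\in S^nW$ is the determinant polynomial, where $W$ has a basis consisting of the matrix coordinates $x^i_j$; the quadratic form $Q$ is the one for which this basis is orthonormal, and it gives an isomorphism $W\cong W^*$. For $P\in S^nW$, the Hessian $H(P)\in S^2W\otimes S^{n-2}W$ is the $(2,n-2)$-polarization of $P$; in coordinates it is the $n^2\times n^2$ symmetric matrix of second partial derivatives of $P$, whose entries are homogeneous polynomials of degree $n-2$. Using the identification $W\cong W^*$ given by $Q$, $H(P)$ is viewed as an endomorphism of $W$ with coefficients in $S^{n-2}W$. $H(P)^{\wedge j}$ is the induced endomorphism of $\Lambda^jW$, so $\mathrm{trace}(H(P)^{\wedge j})$ is the $j$-th coefficient of the characteristic polynomial of $H(P)$ (the $j$-th elementary symmetric function of its eigenvalues, or equivalently the sum of its principal $j\times j$ minors), an element of $S^{j(n-2)}W$. *)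

theory Defs
  imports "HOL-Analysis.Analysis" "HOL-Library.Poly_Mapping"
begin

section \<open>Polynomials over the complex numbers in variables indexed by a type\<close>

type_synonym 'v monomial = "'v \<Rightarrow>\<^sub>0 nat"
type_synonym 'v cpoly = "('v \<Rightarrow>\<^sub>0 nat) \<Rightarrow>\<^sub>0 complex"

definition const :: "complex \<Rightarrow> 'v cpoly"
  where "const c = Poly_Mapping.single 0 c"

definition monom :: "'v monomial \<Rightarrow> 'v cpoly"
  where "monom m = Poly_Mapping.single m 1"

definition var :: "'v \<Rightarrow> 'v cpoly"
  where "var v = monom (Poly_Mapping.single v 1)"

definition scale :: "complex \<Rightarrow> 'v cpoly \<Rightarrow> 'v cpoly"
  where "scale c P = const c * P"

definition mdeg :: "'v monomial \<Rightarrow> nat"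
  where "mdeg m = (\<Sum>v\<in>Poly_Mapping.keys m. Poly_Mapping.lookup m v)"

definition homog :: "nat \<Rightarrow> 'v cpoly set"
  where "homog d = {P. \<forall>m\<in>Poly_Mapping.keys P. mdeg m = d}"

text \<open>Evaluation along a map \<open>h\<close> of the coefficients (a ring homomorphism in all uses below).\<close>

definition eval_with :: "(complex \<Rightarrow> 'a::comm_ring_1) \<Rightarrow> ('v \<Rightarrow> 'a) \<Rightarrow> 'v cpoly \<Rightarrow> 'a"
  where "eval_with h x P =
    (\<Sum>m\<in>Poly_Mapping.keys P. h (Poly_Mapping.lookup P m) *
       (\<Prod>v\<in>Poly_Mapping.keys m. x v ^ Poly_Mapping.lookup m v))"

definition evaluate :: "('v \<Rightarrow> complex) \<Rightarrow> 'v cpoly \<Rightarrow> complex"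
  where "evaluate = eval_with id"

definition substitute :: "('v \<Rightarrow> 'w cpoly) \<Rightarrow> 'v cpoly \<Rightarrow> 'w cpoly"
  where "substitute = eval_with const"

definition partial :: "'v \<Rightarrow> 'v cpoly \<Rightarrow> 'v cpoly"
  where "partial v P =
    (\<Sum>m\<in>Poly_Mapping.keys P.
       Poly_Mapping.single (m - Poly_Mapping.single v 1)
         (of_nat (Poly_Mapping.lookup m v) * Poly_Mapping.lookup P m))"

section \<open>The orthogonal group of the trace form and its action\<close>

text \<open>
  \<open>W\<close> is the space of matrices \<^typ>\<open>complex^'n^'n\<close>; its basis of coordinates consists of the
  variables indexed by \<^typ>\<open>'n \<times> 'n\<close>, the variable \<open>(i, j)\<close> corresponding to the matrix unit
  \<open>matrix_unit (i, j)\<close>.  Thus \<open>S\<^sup>d W\<close> is \<open>homog d :: ('n \<times> 'n) cpoly set\<close>.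
\<close>

definition matrix_scale :: "complex \<Rightarrow> complex^'n^'n \<Rightarrow> complex^'n^'n"
  where "matrix_scale c A = (\<chi> i j. c * A $ i $ j)"

definition matrix_unit :: "'n \<times> 'n \<Rightarrow> complex^'n^'n"
  where "matrix_unit p = (\<chi> i j. if (i, j) = p then 1 else 0)"

definition linear_form :: "complex^'n^'n \<Rightarrow> ('n::finite \<times> 'n) cpoly"
  where "linear_form A = (\<Sum>(i, j)\<in>UNIV. scale (A $ i $ j) (var (i, j)))"

definition Q :: "complex^'n^'n \<Rightarrow> complex"
  where "Q A = trace (A ** transpose A)"

definition orth_group :: "(complex^'n^'n \<Rightarrow> complex^'n^'n) set"
  where "orth_group =
    {g. Vector_Spaces.linear matrix_scale matrix_scale g \<and> bij g \<and> (\<forall>A. Q (g A) = Q A)}"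

text \<open>The action of \<open>GL(W)\<close> on the symmetric algebra of \<open>W\<close> by algebra automorphisms.\<close>

definition act :: "(complex^'n^'n \<Rightarrow> complex^'n^'n) \<Rightarrow> ('n::finite \<times> 'n) cpoly \<Rightarrow> ('n \<times> 'n) cpoly"
  where "act g P = substitute (\<lambda>p. linear_form (g (matrix_unit p))) P"

definition det_poly :: "('n::finite \<times> 'n) cpoly"
  where "det_poly = det (\<chi> i j. var (i, j))"

section \<open>Polynomials on \<open>S\<^sup>n W\<close> and the Zariski topology of its projectivization\<close>

text \<open>
  The coordinates of a form of degree \<open>n\<close> are its coefficients, so a polynomial on \<open>S\<^sup>n W\<close>
  is a polynomial in variables indexed by the monomials of degree \<open>n\<close>.
\<close>

definition forms_on :: "nat \<Rightarrow> nat \<Rightarrow> 'v monomial cpoly set"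
  where "forms_on n d =
    {F \<in> homog d. \<forall>M\<in>Poly_Mapping.keys F. Poly_Mapping.keys M \<subseteq> {m. mdeg m = n}}"

definition eval_at :: "'v monomial cpoly \<Rightarrow> 'v cpoly \<Rightarrow> complex"
  where "eval_at F P = evaluate (Poly_Mapping.lookup P) F"

definition proj_point :: "'v cpoly \<Rightarrow> 'v cpoly set"
  where "proj_point P = {scale c P | c. c \<noteq> 0}"

definition zariski_closed :: "nat \<Rightarrow> 'v cpoly set set \<Rightarrow> bool"
  where "zariski_closed n Z \<longleftrightarrow>
    (\<exists>E \<subseteq> (\<Union>d. forms_on n d).
       Z = {proj_point P | P. P \<in> homog n \<and> P \<noteq> 0 \<and> (\<forall>F\<in>E. eval_at F P = 0)})"

definition det_orbit_closure :: "('n::finite \<times> 'n) cpoly set set"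
  where "det_orbit_closure =
    zariski_closed CARD('n) hull ((\<lambda>g. proj_point (act g det_poly)) ` orth_group)"

text \<open>
  The action \<open>(g \<cdot> F)(P) = F(g\<inverse> \<cdot> P)\<close> on polynomials on \<open>S\<^sup>n W\<close>: the coordinate function
  ``coefficient of \<open>m\<close>'' is sent to the linear form giving the coefficient of \<open>m\<close>
  in \<open>g\<inverse> \<cdot> P\<close>, expressed in the coefficients of \<open>P\<close>.
\<close>

definition act_forms :: "nat \<Rightarrow> (complex^'n^'n \<Rightarrow> complex^'n^'n) \<Rightarrow>
    ('n::finite \<times> 'n) monomial cpoly \<Rightarrow> ('n \<times> 'n) monomial cpoly"
  where "act_forms n g F =
    substitute (\<lambda>m. \<Sum>m' | mdeg m' = n.
      scale (Poly_Mapping.lookup (act (inv g) (monom m')) m) (var m')) F"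

definition orth_module :: "nat \<Rightarrow> ('n::finite \<times> 'n) monomial cpoly set \<Rightarrow> bool"
  where "orth_module n M \<longleftrightarrow>
    module.subspace scale M \<and> (\<forall>g\<in>orth_group. \<forall>F\<in>M. act_forms n g F \<in> M)"

section \<open>The Hessian and its exterior powers\<close>

definition hessian :: "('v::finite) cpoly \<Rightarrow> ('v cpoly)^'v^'v"
  where "hessian P = (\<chi> p q. partial p (partial q P))"

text \<open>
  For a finite index type \<open>'w\<close>, the wedges \<open>e\<^sub>I = e\<^bsub>i\<^sub>1\<^esub> \<and> \<dots> \<and> e\<^bsub>i\<^sub>j\<^esub>\<close>, one for each set \<open>I\<close> of \<open>j\<close>
  indices listed in some fixed order, form a basis of the \<open>j\<close>-th exterior power.
  The matrix of the endomorphism induced by \<open>A\<close> has as entry \<open>(I, J)\<close> the coefficient of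
  \<open>e\<^sub>I\<close> in \<open>A e\<^bsub>j\<^sub>1\<^esub> \<and> A e\<^bsub>j\<^sub>2\<^esub> \<and> \<dots>\<close>.  It is indexed by all subsets here, and is zero
  outside the block of subsets of size \<open>j\<close>.
\<close>

definition listing :: "'w set \<Rightarrow> 'w list"
  where "listing I = (SOME xs. set xs = I \<and> distinct xs)"

definition exterior_power :: "nat \<Rightarrow> 'a::comm_ring_1^'w^'w \<Rightarrow> 'a^('w set)^('w::finite set)"
  where "exterior_power j A = (\<chi> I J.
    if card I = j \<and> card J = j
    then \<Sum>\<sigma> | \<sigma> permutes {..<j}.
           of_int (sign \<sigma>) * (\<Prod>k<j. A $ (listing I ! \<sigma> k) $ (listing J ! k))
    else 0)"

end

theory Submission
  imports Defs
begin

text \<open>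
  Write \<open>R(P) = trace (H(P)\<^sup>\<and>\<^sup>j)\<close>.  The chain rule shows that \<open>R\<close> commutes with orthogonal
  substitutions, and \<open>R(-P) = -R(P)\<close> for odd \<open>j\<close>.  If \<open>X\<close> is a real singular matrix, some reflection
  \<open>S\<close> fixes \<open>X\<close> under left multiplication; it changes the sign of the determinant, so \<open>R(det)\<close> takes
  opposite values at \<open>X\<close> and at \<open>SX = X\<close> and therefore vanishes there.  That already forces
  \<open>det\<close> to divide \<open>R(det)\<close>: in \<open>det(Y + s I)\<close>, monic in \<open>s\<close>, the remainder of the division has degree
  less than \<open>n\<close> in \<open>s\<close>, yet it has \<open>n\<close> real roots for all real \<open>Y\<close> in an open set.

  Divisibility passes from the orbit to its closure because, for \<open>P \<noteq> 0\<close>, the products of \<open>P\<close> with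
  monomials are linearly independent, so that ``\<open>R(P)\<close> is one of their combinations'' is a closed
  condition.  The module is the space of all forms of the given degree vanishing on the orbit; it
  contains powers of the coefficients of the Laplacian of \<open>P\<close>, since the determinant is harmonic.
\<close>

section \<open>Ring homomorphisms\<close>

text \<open>Real matrices are used because a kernel vector must be normalized to define a
  reflection: over the complex numbers it may be isotropic for \<open>Q\<close>, and then no
  reflection along it exists. The price is that vanishing is known only at real singular matrices,
  so the Nullstellensatz does not apply directly. Division by a polynomial monic in \<open>s\<close>
  replaces it and also avoids the irreducibility of the determinant; setting \<open>s = 0\<close> at
  the end recovers the divisibility.

  For the closure, the quotient must be sought among finitely many monomials. Orthogonal
  substitutions preserve degrees, so a degree bound for the quotient at \<open>det_poly\<close>
  serves the whole orbit. As the closure is a hull, a bad point \<open>P\<close> is excluded by a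
  single form that vanishes on the orbit but not at \<open>P\<close>.\<close>

definition is_ring_hom :: "('a::comm_ring_1 \<Rightarrow> 'b::comm_ring_1) \<Rightarrow> bool"
  where "is_ring_hom f \<longleftrightarrow>
    f 1 = 1 \<and> (\<forall>a b. f (a + b) = f a + f b) \<and> (\<forall>a b. f (a * b) = f a * f b)"

lemma is_ring_homI:
  assumes "f 1 = 1" "\<And>a b. f (a + b) = f a + f b" "\<And>a b. f (a * b) = f a * f b"
  shows "is_ring_hom f"
  using assms by (simp add: is_ring_hom_def)

context
  fixes f :: "'a::comm_ring_1 \<Rightarrow> 'b::comm_ring_1"
  assumes f: "is_ring_hom f"
begin

lemma hom_1: "f 1 = 1"
  and hom_add: "f (a + b) = f a + f b"
  and hom_mult: "f (a * b) = f a * f b"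
  using f by (simp_all add: is_ring_hom_def)

lemma hom_0: "f 0 = 0"
  using hom_add[of 0 0] by simp

lemma hom_uminus: "f (- a) = - f a"
  using hom_add[of "- a" a] by (simp add: hom_0 eq_neg_iff_add_eq_0)

lemma hom_diff: "f (a - b) = f a - f b"
  using hom_add[of a "- b"] by (simp add: hom_uminus)

lemma hom_sum: "f (sum g S) = (\<Sum>x\<in>S. f (g x))"
  by (induction S rule: infinite_finite_induct) (simp_all add: hom_0 hom_add)

lemma hom_prod: "f (prod g S) = (\<Prod>x\<in>S. f (g x))"
  by (induction S rule: infinite_finite_induct) (simp_all add: hom_1 hom_mult)

lemma hom_power: "f (a ^ k) = f a ^ k"
  by (induction k) (simp_all add: hom_1 hom_mult)

lemma hom_of_nat: "f (of_nat k) = of_nat k"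
  by (induction k) (simp_all add: hom_0 hom_1 hom_add)

lemma hom_of_int: "f (of_int k) = of_int k"
  by (cases k) (simp_all add: hom_of_nat hom_uminus hom_diff hom_1)

lemma hom_det: "f (det A) = det (\<chi> i j. f (A $ i $ j))"
  by (simp add: det_def hom_sum hom_mult hom_of_int hom_prod)

lemma hom_trace: "f (trace A) = trace (\<chi> i j. f (A $ i $ j))"
  by (simp add: trace_def hom_sum)

lemma hom_matrix_mult:
  "(\<chi> i j. f ((A ** B) $ i $ j)) = (\<chi> i j. f (A $ i $ j)) ** (\<chi> i j. f (B $ i $ j))"
  by (simp add: matrix_matrix_mult_def hom_sum hom_mult)

text \<open>The entries of an exterior power are integer polynomials in the entries of the matrix.
  Applied to \<open>act g\<close>, this pulls the substitution out of the transformed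
  Hessian.\<close>

lemma hom_trace_exterior_power:
  "f (trace (exterior_power j A)) = trace (exterior_power j (\<chi> p q. f (A $ p $ q)))"
proof -
  have "(\<chi> I J. f (exterior_power j A $ I $ J)) = exterior_power j (\<chi> p q. f (A $ p $ q))"
    by (simp add: exterior_power_def vec_eq_iff hom_0 hom_sum hom_mult hom_of_int hom_prod)
  then show ?thesis
    by (simp add: hom_trace)
qed

end

lemma is_ring_hom_comp: "is_ring_hom f \<Longrightarrow> is_ring_hom g \<Longrightarrow> is_ring_hom (\<lambda>x. f (g x))"
  by (simp add: is_ring_hom_def)

lemma is_ring_hom_id: "is_ring_hom id"
  by (simp add: is_ring_hom_def)

lemma is_ring_hom_const: "is_ring_hom const"
  by (simp add: is_ring_hom_def const_def single_add mult_single)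

lemma is_ring_hom_pCons: "is_ring_hom (\<lambda>c. [:c:])"
  by (simp add: is_ring_hom_def one_pCons)

lemma is_ring_hom_poly: "is_ring_hom (\<lambda>p. poly p t)"
  by (simp add: is_ring_hom_def)

lemma is_ring_hom_map_poly:
  assumes "is_ring_hom f"
  shows "is_ring_hom (map_poly f)"
proof -
  note [simp] = hom_0[OF assms] hom_1[OF assms] hom_add[OF assms] hom_mult[OF assms]
  show ?thesis
    by (intro is_ring_homI)
      (simp_all add: poly_eq_iff coeff_map_poly coeff_mult hom_sum[OF assms])
qed

section \<open>Polynomials in several variables\<close>

lemma lookup_const: "Poly_Mapping.lookup (const c) m = (if m = 0 then c else 0)"
  by (simp add: const_def lookup_single when_def)

lemma lookup_monom: "Poly_Mapping.lookup (monom m) k = (if k = m then 1 else 0)"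
  by (auto simp add: monom_def lookup_single when_def)

lemma const_mult_monom: "const c * monom m = Poly_Mapping.single m c"
  by (simp add: const_def monom_def mult_single)

lemma monom_0: "monom 0 = 1"
  by (simp add: monom_def)

lemma monom_add: "monom (k + m) = monom k * monom m"
  by (simp add: monom_def mult_single)

lemma lookup_const_mult:
  "Poly_Mapping.lookup (const c * P) m = c * Poly_Mapping.lookup P m"
proof -
  have "const c * P = Poly_Mapping.map ((*) c) P"
    by (simp add: const_def mult_map_scale_conv_mult)
  then show ?thesis
    by (simp add: Poly_Mapping.map.rep_eq when_def)
qed

lemma lookup_scale: "Poly_Mapping.lookup (scale c P) m = c * Poly_Mapping.lookup P m"
  by (simp add: scale_def lookup_const_mult)

lemma cpoly_eq_sum:
  assumes "finite K" "Poly_Mapping.keys P \<subseteq> K"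
  shows "P = (\<Sum>m\<in>K. const (Poly_Mapping.lookup P m) * monom m)"
proof (rule poly_mapping_eqI)
  fix k
  have "(\<Sum>m\<in>K. Poly_Mapping.lookup P m * (if k = m then 1 else 0)) =
      (\<Sum>m\<in>K. if k = m then Poly_Mapping.lookup P m else 0)"
    by (intro sum.cong) auto
  also have "\<dots> = Poly_Mapping.lookup P k"
    using assms by (auto simp: in_keys_iff)
  finally show "Poly_Mapping.lookup P k =
      Poly_Mapping.lookup (\<Sum>m\<in>K. const (Poly_Mapping.lookup P m) * monom m) k"
    by (simp add: lookup_sum lookup_const_mult lookup_monom)
qed

lemma monomial_induct [case_names zero add]:
  assumes "R 0" "\<And>m v. R m \<Longrightarrow> R (m + Poly_Mapping.single v 1)"
  shows "R (m :: 'v monomial)"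
proof (induction "\<Sum>v\<in>Poly_Mapping.keys m. Poly_Mapping.lookup m v" arbitrary: m)
  case 0
  then have "m = 0"
    by (intro poly_mapping_eqI) (auto simp: in_keys_iff)
  then show ?case
    using assms by simp
next
  case (Suc k)
  then obtain v where v: "v \<in> Poly_Mapping.keys m"
    by (metis sum.neutral Zero_not_Suc)
  define m' where "m' = m - Poly_Mapping.single v 1"
  have m: "m = m' + Poly_Mapping.single v 1"
    using v by (intro poly_mapping_eqI)
      (auto simp: m'_def lookup_add lookup_minus lookup_single when_def in_keys_iff)
  have "(\<Sum>v\<in>Poly_Mapping.keys m'. Poly_Mapping.lookup m' v) =
      (\<Sum>v\<in>Poly_Mapping.keys m. Poly_Mapping.lookup m' v)"
    by (rule sum.mono_neutral_left) (auto simp: m'_def in_keys_iff lookup_minus)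
  moreover have "(\<Sum>w\<in>Poly_Mapping.keys m. Poly_Mapping.lookup m w) =
      (\<Sum>w\<in>Poly_Mapping.keys m. Poly_Mapping.lookup m' w) + 1"
    using v by (subst m) (simp add: lookup_add sum.distrib lookup_single when_def)
  ultimately show ?case
    using Suc m assms(2)[of m' v] by simp
qed

lemma cpoly_induct [case_names const var add mult]:
  fixes P :: "'v cpoly"
  assumes const: "\<And>c. R (const c)" and var: "\<And>v. R (var v)"
    and add: "\<And>P1 P2. R P1 \<Longrightarrow> R P2 \<Longrightarrow> R (P1 + P2)"
    and mult: "\<And>P1 P2. R P1 \<Longrightarrow> R P2 \<Longrightarrow> R (P1 * P2)"
  shows "R P"
proof -
  have Q0: "R 0"
    using const[of 0] by (simp add: const_def)
  have "R (monom m)" for m :: "'v monomial"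
  proof (induction m rule: monomial_induct)
    case zero
    then show ?case
      using const[of 1] by (simp add: const_def monom_0)
  next
    case (add m v)
    then show ?case
      using mult[OF add var[of v]] by (simp add: var_def monom_add)
  qed
  note mon = this
  have "R (\<Sum>m\<in>K. const (c m) * monom m)" if "finite K" for K :: "'v monomial set" and c
    using that by (induction K rule: finite_induct) (simp_all add: Q0 add mult const mon)
  from this[of "Poly_Mapping.keys P" "Poly_Mapping.lookup P"] show ?thesis
    by (simp flip: cpoly_eq_sum)
qed

section \<open>Evaluation along a homomorphism of the coefficients\<close>

lemma eval_with_superset:
  assumes "h 0 = 0" "finite K" "Poly_Mapping.keys P \<subseteq> K"
  shows "eval_with h x P =
    (\<Sum>m\<in>K. h (Poly_Mapping.lookup P m) *
      (\<Prod>v\<in>Poly_Mapping.keys m. x v ^ Poly_Mapping.lookup m v))"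
  unfolding eval_with_def
  by (rule sum.mono_neutral_left) (use assms in \<open>auto simp: in_keys_iff\<close>)

lemma monomial_value_add:
  fixes x :: "'v \<Rightarrow> 'a::comm_ring_1"
  shows "(\<Prod>v\<in>Poly_Mapping.keys (k + m). x v ^ Poly_Mapping.lookup (k + m) v) =
    (\<Prod>v\<in>Poly_Mapping.keys k. x v ^ Poly_Mapping.lookup k v) *
    (\<Prod>v\<in>Poly_Mapping.keys m. x v ^ Poly_Mapping.lookup m v)"
proof -
  define K where "K = Poly_Mapping.keys k \<union> Poly_Mapping.keys m"
  have *: "(\<Prod>v\<in>Poly_Mapping.keys l. x v ^ Poly_Mapping.lookup l v) =
      (\<Prod>v\<in>K. x v ^ Poly_Mapping.lookup l v)" if "Poly_Mapping.keys l \<subseteq> K" for l :: "'v monomial"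
    by (rule prod.mono_neutral_left) (use that in \<open>auto simp: K_def in_keys_iff\<close>)
  have "Poly_Mapping.keys (k + m) \<subseteq> K"
    unfolding K_def by (rule Poly_Mapping.keys_add)
  then show ?thesis
    by (subst (1 2 3) *) (auto simp: K_def lookup_add power_add prod.distrib)
qed

context
  fixes h :: "complex \<Rightarrow> 'a::comm_ring_1"
  assumes h: "is_ring_hom h"
begin

lemma eval_with_single:
  "eval_with h x (Poly_Mapping.single m c) =
    h c * (\<Prod>v\<in>Poly_Mapping.keys m. x v ^ Poly_Mapping.lookup m v)"
  by (subst eval_with_superset[where K = "{m}"]) (auto simp: hom_0[OF h])

lemma eval_with_const [simp]: "eval_with h x (const c) = h c"
  by (simp add: const_def eval_with_single)

lemma eval_with_var [simp]: "eval_with h x (var v) = x v"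
  by (simp add: var_def monom_def eval_with_single hom_1[OF h])

lemma eval_with_add: "eval_with h x (P + P') = eval_with h x P + eval_with h x P'"
proof -
  define K where "K = Poly_Mapping.keys P \<union> Poly_Mapping.keys P'"
  have *: "h 0 = 0" "finite K" "Poly_Mapping.keys P \<subseteq> K" "Poly_Mapping.keys P' \<subseteq> K"
    "Poly_Mapping.keys (P + P') \<subseteq> K"
    using Poly_Mapping.keys_add[of P P'] by (auto simp: K_def hom_0[OF h])
  show ?thesis
    by (subst (1 2 3) eval_with_superset[where K = K])
      (simp_all add: * lookup_add hom_add[OF h] distrib_right sum.distrib)
qed

lemma eval_with_sum: "eval_with h x (sum g S) = (\<Sum>s\<in>S. eval_with h x (g s))"
proof (induction S rule: infinite_finite_induct)
  case (insert s S)
  then show ?case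
    by (simp add: eval_with_add)
qed (simp_all add: eval_with_def)

lemma eval_with_mult: "eval_with h x (P * P') = eval_with h x P * eval_with h x P'"
proof -
  have eq: "P = (\<Sum>m\<in>Poly_Mapping.keys P. Poly_Mapping.single m (Poly_Mapping.lookup P m))" for P :: "'b cpoly"
    using cpoly_eq_sum[of "Poly_Mapping.keys P" P] by (simp add: const_mult_monom)
  obtain K c where P: "P = (\<Sum>m\<in>K. Poly_Mapping.single m (c m))"
    using eq by blast
  obtain K' c' where P': "P' = (\<Sum>m\<in>K'. Poly_Mapping.single m (c' m))"
    using eq by blast
  have 1: "eval_with h x (Poly_Mapping.single k c * Poly_Mapping.single m d) =
      eval_with h x (Poly_Mapping.single k c) * eval_with h x (Poly_Mapping.single m d)" for k m c d
    by (simp add: mult_single eval_with_single monomial_value_add hom_mult[OF h])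
  show ?thesis
    by (simp add: P P' sum_product eval_with_sum 1)
qed

lemma is_ring_hom_eval_with: "is_ring_hom (eval_with h x)"
  using eval_with_const[of x 1]
  by (intro is_ring_homI) (simp_all add: eval_with_add eval_with_mult const_def hom_1[OF h])

end

text \<open>Constants and variables generate the polynomial ring. Identities between compositions of
  evaluations and substitutions are reduced to a check on these generators.\<close>

lemma ring_hom_eqI:
  assumes f: "is_ring_hom f" and g: "is_ring_hom g"
    and "\<And>c. f (const c) = g (const c)" "\<And>v. f (var v) = g (var v)"
  shows "f P = g P"
  by (induction P rule: cpoly_induct)
    (simp_all add: assms(3,4) hom_add[OF f] hom_add[OF g] hom_mult[OF f] hom_mult[OF g])

lemma is_ring_hom_evaluate: "is_ring_hom (evaluate x)"
  by (simp add: evaluate_def is_ring_hom_eval_with is_ring_hom_id)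

lemma is_ring_hom_substitute: "is_ring_hom (substitute x)"
  by (simp add: substitute_def is_ring_hom_eval_with is_ring_hom_const)

lemma evaluate_const [simp]: "evaluate x (const c) = c"
  and evaluate_var [simp]: "evaluate x (var v) = x v"
  by (simp_all add: evaluate_def is_ring_hom_id)

lemma substitute_const [simp]: "substitute x (const c) = const c"
  and substitute_var [simp]: "substitute x (var v) = x v"
  by (simp_all add: substitute_def is_ring_hom_const)

lemma evaluate_substitute:
  "evaluate x (substitute y P) = evaluate (\<lambda>v. evaluate x (y v)) P"
  by (rule ring_hom_eqI[where P = P])
    (simp_all add: is_ring_hom_comp is_ring_hom_evaluate is_ring_hom_substitute)

lemma substitute_substitute:
  "substitute x (substitute y P) = substitute (\<lambda>v. substitute x (y v)) P"
  by (rule ring_hom_eqI[where P = P])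
    (simp_all add: is_ring_hom_comp is_ring_hom_substitute)

lemma substitute_vars: "substitute var P = P"
  by (rule ring_hom_eqI[where P = P])
    (simp_all add: is_ring_hom_substitute is_ring_homI)

section \<open>Partial derivatives\<close>

lemma lookup_partial:
  "Poly_Mapping.lookup (partial v P) m =
    (of_nat (Poly_Mapping.lookup m v) + 1) * Poly_Mapping.lookup P (m + Poly_Mapping.single v 1)"
proof -
  let ?e = "Poly_Mapping.single v (1::nat)"
  have "Poly_Mapping.lookup (partial v P) m =
      (\<Sum>k\<in>Poly_Mapping.keys P. (of_nat (Poly_Mapping.lookup k v) * Poly_Mapping.lookup P k) when k - ?e = m)"
    by (simp add: partial_def lookup_sum lookup_single)
  also have "\<dots> = (\<Sum>k\<in>Poly_Mapping.keys P.
      if k = m + ?e then of_nat (Poly_Mapping.lookup k v) * Poly_Mapping.lookup P k else 0)"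
  proof (rule sum.cong)
    fix k
    show "((of_nat (Poly_Mapping.lookup k v) * Poly_Mapping.lookup P k) when k - ?e = m) =
      (if k = m + ?e then of_nat (Poly_Mapping.lookup k v) * Poly_Mapping.lookup P k else 0)"
    \<comment> \<open>Truncated subtraction is harmless: where it fails to lower the exponent of
      \<open>v\<close>, the coefficient of the term is zero.\<close>
    proof (cases "Poly_Mapping.lookup k v = 0")
      case False
      then have "k - ?e = m \<longleftrightarrow> k = m + ?e"
        by (auto simp: poly_mapping_eq_iff fun_eq_iff lookup_add lookup_minus lookup_single when_def)
      then show ?thesis
        by (simp add: when_def)
    qed (auto simp: when_def)
  qed simp
  also have "\<dots> = of_nat (Poly_Mapping.lookup (m + ?e) v) * Poly_Mapping.lookup P (m + ?e)"
    by (auto simp: in_keys_iff)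
  finally show ?thesis
    by (simp add: lookup_add algebra_simps)
qed

lemma partial_add: "partial v (P + P') = partial v P + partial v P'"
  by (rule poly_mapping_eqI) (simp add: lookup_partial lookup_add distrib_left)

lemma partial_uminus: "partial v (- P) = - partial v P"
  by (rule poly_mapping_eqI) (simp add: lookup_partial)

lemma partial_sum: "partial v (sum g S) = (\<Sum>s\<in>S. partial v (g s))"
  by (rule poly_mapping_eqI) (simp add: lookup_partial lookup_sum sum_distrib_left)

lemma partial_const [simp]: "partial v (const c) = 0"
proof (rule poly_mapping_eqI)
  fix m :: "'a monomial"
  have "Poly_Mapping.lookup (m + Poly_Mapping.single v 1) v \<noteq> 0"
    by (simp add: lookup_add)
  then have "m + Poly_Mapping.single v 1 \<noteq> 0"
    by force
  then show "Poly_Mapping.lookup (partial v (const c)) m = Poly_Mapping.lookup 0 m"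
    by (simp add: lookup_partial lookup_const)
qed

lemma partial_monom:
  "partial v (monom m) = const (of_nat (Poly_Mapping.lookup m v)) * monom (m - Poly_Mapping.single v 1)"
proof -
  have "partial v (monom m) = Poly_Mapping.single (m - Poly_Mapping.single v 1) (of_nat (Poly_Mapping.lookup m v))"
    by (simp add: partial_def monom_def)
  then show ?thesis
    by (simp add: const_mult_monom)
qed

lemma partial_var: "partial v (var w) = (if v = w then 1 else 0)"
proof -
  have "partial v (var w) = const (of_nat (Poly_Mapping.lookup (Poly_Mapping.single w 1) v)) * monom (Poly_Mapping.single w 1 - Poly_Mapping.single v 1)"
    unfolding var_def by (rule partial_monom)
  then show ?thesis
    by (auto simp: lookup_single when_def monom_0 const_def)
qed

lemma partial_const_mult: "partial v (const c * P) = const c * partial v P"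
  by (rule poly_mapping_eqI) (simp add: lookup_partial lookup_const_mult)

lemma partial_monom_mult:
  "partial v (monom k * monom m) = partial v (monom k) * monom m + monom k * partial v (monom m)"
proof -
  let ?e = "Poly_Mapping.single v (1::nat)"
  have 1: "const (of_nat (Poly_Mapping.lookup k v)) * monom (k + m - ?e) =
      const (of_nat (Poly_Mapping.lookup k v)) * (monom (k - ?e) * monom m)" for k m :: "'a monomial"
  proof (cases "Poly_Mapping.lookup k v = 0")
    case False
    then have "k + m - ?e = k - ?e + m"
      by (auto simp: poly_mapping_eq_iff fun_eq_iff lookup_add lookup_minus lookup_single when_def)
    then show ?thesis
      by (simp add: monom_add)
  qed (simp add: const_def)
  have "partial v (monom k * monom m) =
      const (of_nat (Poly_Mapping.lookup k v)) * monom (k + m - ?e) +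
      const (of_nat (Poly_Mapping.lookup m v)) * monom (m + k - ?e)"
    by (simp add: partial_monom lookup_add hom_add[OF is_ring_hom_const] distrib_right add.commute
        flip: monom_add)
  then show ?thesis
    unfolding 1 by (simp add: partial_monom mult_ac)
qed

lemma partial_mult: "partial v (P * P') = partial v P * P' + P * partial v P'"
proof -
  have eq: "P = (\<Sum>m\<in>Poly_Mapping.keys P. const (Poly_Mapping.lookup P m) * monom m)" for P :: "'a cpoly"
    by (rule cpoly_eq_sum) simp_all
  obtain K c where P: "P = (\<Sum>m\<in>K. const (c m) * monom m)"
    using eq by blast
  obtain K' c' where P': "P' = (\<Sum>m\<in>K'. const (c' m) * monom m)"
    using eq by blast
  have 1: "partial v (const a * monom k * (const b * monom m)) =
      partial v (const a * monom k) * (const b * monom m) + const a * monom k * partial v (const b * monom m)"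
    for a b k m
  proof -
    have "partial v (const a * monom k * (const b * monom m)) =
        partial v (const a * (const b * (monom k * monom m)))"
      by (simp add: mult_ac)
    then show ?thesis
      by (simp add: partial_const_mult partial_monom_mult algebra_simps)
  qed
  show ?thesis
    by (simp add: P P' sum_product partial_sum 1 sum.distrib)
qed

text \<open>Both sides are additive and obey the Leibniz rule in \<open>P\<close>, so generators
  suffice. The target ring and the derivation are left abstract to serve two cases:
  \<open>partial q\<close> after a linear substitution, and \<open>pderiv\<close> along a coordinate
  line.\<close>

lemma derivation_chain_rule:
  fixes P :: "'v::finite cpoly"
  assumes h: "is_ring_hom h"
    and d_add: "\<And>a b. d (a + b) = d a + d b"
    and d_mult: "\<And>a b. d (a * b) = d a * b + a * d b"
    and d_const: "\<And>c. d (h c) = 0"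
  shows "d (eval_with h x P) = (\<Sum>v\<in>UNIV. d (x v) * eval_with h x (partial v P))"
proof (induction P rule: cpoly_induct)
  case (const c)
  show ?case
    by (simp add: h d_const) (simp add: eval_with_def)
next
  case (var w)
  have "(\<Sum>v\<in>UNIV. d (x v) * eval_with h x (partial v (var w))) =
      (\<Sum>v\<in>UNIV. if v = w then d (x v) else 0)"
    by (intro sum.cong)
      (auto simp: partial_var hom_0[OF is_ring_hom_eval_with[OF h]] hom_1[OF is_ring_hom_eval_with[OF h]])
  then show ?case
    by (simp add: h)
next
  case (add P1 P2)
  then show ?case
    by (simp add: eval_with_add h d_add partial_add distrib_left sum.distrib)
next
  case (mult P1 P2)
  have "d (eval_with h x (P1 * P2)) =
      (\<Sum>v\<in>UNIV. d (x v) * eval_with h x (partial v P1)) * eval_with h x P2 +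
      eval_with h x P1 * (\<Sum>v\<in>UNIV. d (x v) * eval_with h x (partial v P2))"
    by (simp add: eval_with_mult h d_mult mult)
  then show ?case
    by (simp add: partial_mult eval_with_add eval_with_mult h sum_distrib_left sum_distrib_right
        distrib_left sum.distrib mult_ac)
qed

section \<open>The trace of an exterior power\<close>

definition principal_minor :: "'a::comm_ring_1^'w^'w \<Rightarrow> 'w::finite set \<Rightarrow> 'a"
  where "principal_minor A I = (\<Sum>\<pi> | \<pi> permutes I. of_int (sign \<pi>) * (\<Prod>i\<in>I. A $ \<pi> i $ i))"

text \<open>On the diagonal, rows and columns are listed by the same enumeration. Conjugating by it
  turns permutations of positions into permutations of \<open>I\<close> with the same sign, so the
  arbitrary choice of \<open>listing\<close> drops out.\<close>

lemma exterior_power_diagonal: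
  fixes A :: "'a::comm_ring_1^'w^'w::finite"
  assumes "card I = j"
  shows "exterior_power j A $ I $ I = principal_minor A I"
proof -
  obtain xs where "set xs = I \<and> distinct xs"
    using finite_distinct_list[of I] by auto
  then have l: "set (listing I) = I \<and> distinct (listing I)"
    unfolding listing_def by (rule someI[where P = "\<lambda>xs. set xs = I \<and> distinct xs"])
  define b where "b = (!) (listing I)"
  have len: "length (listing I) = j"
    using l assms distinct_card by metis
  have b: "bij_betw b {..<j} I"
    unfolding b_def using l len by (intro bij_betw_nth) auto
  then have inj: "inj_on b {..<j}"
    by (simp add: bij_betw_def)
  define c where "c = inv_into {..<j} b"
  have c: "bij_betw c I {..<j}"
    unfolding c_def by (rule bij_betw_inv_into[OF b])
  have cb: "c (b k) = k" if "k \<in> {..<j}" for k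
    using that inj by (simp add: c_def)
  have bc: "b (c i) = i" if "i \<in> I" for i
    using that b by (simp add: c_def bij_betw_inv_into_right)
  have "(\<Sum>\<sigma> | \<sigma> permutes {..<j}. of_int (sign \<sigma>) * (\<Prod>k<j. A $ b (\<sigma> k) $ b k)) = principal_minor A I"
    unfolding principal_minor_def
  proof (rule sum.reindex_bij_witness[where i = "map_permutation I c" and j = "map_permutation {..<j} b"])
    fix \<sigma> assume "\<sigma> \<in> {\<sigma>. \<sigma> permutes {..<j}}"
    then have \<sigma>: "\<sigma> permutes {..<j}" by simp
    show "map_permutation I c (map_permutation {..<j} b \<sigma>) = \<sigma>"
      by (rule map_permutation_compose_inv[OF b \<sigma> cb])
    show "map_permutation {..<j} b \<sigma> \<in> {\<pi>. \<pi> permutes I}"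
      using map_permutation_permutes[OF b \<sigma>] by simp
    have "(\<Prod>i\<in>I. A $ map_permutation {..<j} b \<sigma> i $ i) =
        (\<Prod>k<j. A $ map_permutation {..<j} b \<sigma> (b k) $ b k)"
      by (rule prod.reindex_bij_betw[OF b, symmetric])
    also have "\<dots> = (\<Prod>k<j. A $ b (\<sigma> k) $ b k)"
      by (intro prod.cong) (simp_all add: map_permutation_apply[OF inj])
    finally show "of_int (sign (map_permutation {..<j} b \<sigma>)) *
        (\<Prod>i\<in>I. A $ map_permutation {..<j} b \<sigma> i $ i) =
        of_int (sign \<sigma>) * (\<Prod>k<j. A $ b (\<sigma> k) $ b k)"
      using sign_map_permutation[OF inj \<sigma>] by simp
  next
    fix \<pi> assume "\<pi> \<in> {\<pi>. \<pi> permutes I}"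
    then have \<pi>: "\<pi> permutes I" by simp
    show "map_permutation {..<j} b (map_permutation I c \<pi>) = \<pi>"
      by (rule map_permutation_compose_inv[OF c \<pi> bc])
    show "map_permutation I c \<pi> \<in> {\<sigma>. \<sigma> permutes {..<j}}"
      using map_permutation_permutes[OF c \<pi>] by simp
  qed
  then show ?thesis
    using assms by (simp add: exterior_power_def b_def)
qed

lemma trace_exterior_power:
  "trace (exterior_power j A) = (\<Sum>I | card I = j. principal_minor A I)"
proof -
  have "trace (exterior_power j A) = (\<Sum>I\<in>UNIV. if card I = j then principal_minor A I else 0)"
    unfolding trace_def
    by (intro sum.cong) (auto simp: exterior_power_diagonal, simp add: exterior_power_def)
  then show ?thesis
    by (simp add: sum.If_cases)
qed

text \<open>This is \<open>I + t A\<close> rather than \<open>t I - A\<close>, so that the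
  elementary symmetric functions of the eigenvalues appear as coefficients without signs and in
  increasing order.\<close>

definition char_matrix :: "'a::comm_ring_1^'w^'w \<Rightarrow> 'a poly^'w^'w"
  where "char_matrix A = (\<chi> i k. [:if i = k then 1 else 0, A $ i $ k:])"

lemma monom_prod: "(\<Prod>i\<in>I. [:0, c i:]) = Polynomial.monom (\<Prod>i\<in>I. c i) (card I)"
proof (induction I rule: infinite_finite_induct)
  case (insert i I)
  have "[:0, c i:] = Polynomial.monom (c i) 1"
    by (simp add: Polynomial.monom_Suc Polynomial.monom_0)
  then show ?case
    using insert by (simp add: mult_monom)
qed simp_all

text \<open>Expand every factor of the Leibniz formula into its constant and its linear part. The
  set \<open>I\<close> of columns contributing the linear part determines the power of
  \<open>t\<close>, and summing over permutations leaves the principal minor on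
  \<open>I\<close>.\<close>

lemma coeff_det_char_matrix:
  fixes A :: "'a::comm_ring_1^'w^'w::finite"
  shows "poly.coeff (det (char_matrix A)) j = trace (exterior_power j A)"
proof -
  let ?s = "\<lambda>p. of_int (sign p) :: 'a poly"
  let ?d = "\<lambda>p i. [:if p i = i then 1 else 0 :: 'a:]"
  \<comment> \<open>The transposition brings the Leibniz terms into the form
    \<open>A $ p i $ i\<close> used by \<open>principal_minor\<close>.\<close>
  have "det (char_matrix A) = det (transpose (char_matrix A))"
    by (simp add: det_transpose)
  also have "\<dots> = (\<Sum>p | p permutes (UNIV :: 'w set). ?s p * (\<Prod>i\<in>UNIV. [:0, A $ p i $ i:] + ?d p i))"
    by (simp add: det_def transpose_def char_matrix_def)
  also have "\<dots> = (\<Sum>p | p permutes (UNIV :: 'w set). \<Sum>I\<in>UNIV.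
      ?s p * ((\<Prod>i\<in>I. [:0, A $ p i $ i:]) * (\<Prod>i\<in>- I. ?d p i)))"
    by (subst prod_add) (simp_all add: sum_distrib_left Compl_eq_Diff_UNIV)
  also have "\<dots> = (\<Sum>I\<in>UNIV. \<Sum>p | p permutes (UNIV :: 'w set).
      ?s p * ((\<Prod>i\<in>I. [:0, A $ p i $ i:]) * (\<Prod>i\<in>- I. ?d p i)))"
    by (rule sum.swap)
  also have "\<dots> = (\<Sum>I\<in>UNIV. \<Sum>p | p permutes I.
      ?s p * ((\<Prod>i\<in>I. [:0, A $ p i $ i:]) * (\<Prod>i\<in>- I. ?d p i)))"
  \<comment> \<open>A permutation that moves a point outside \<open>I\<close> picks an off-diagonal
    zero of the identity matrix, so only permutations of \<open>I\<close> survive.\<close>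
  proof (rule sum.cong[OF refl], rule sum.mono_neutral_right)
    fix I :: "'w set"
    show "finite {p. p permutes (UNIV :: 'w set)}"
      by (simp add: finite_permutations)
    show "{p. p permutes I} \<subseteq> {p. p permutes UNIV}"
      by (auto intro: permutes_subset)
    show "\<forall>p\<in>{p. p permutes UNIV} - {p. p permutes I}.
        ?s p * ((\<Prod>i\<in>I. [:0, A $ p i $ i:]) * (\<Prod>i\<in>- I. ?d p i)) = 0"
    proof
      fix p assume p: "p \<in> {p. p permutes UNIV} - {p. p permutes I}"
      then obtain i where "i \<in> - I" "p i \<noteq> i"
        using permutes_superset[of p UNIV I] by auto
      then have "(\<Prod>i\<in>- I. ?d p i) = 0"
        by (intro prod_zero) (auto intro!: bexI[of _ i])
      then show "?s p * ((\<Prod>i\<in>I. [:0, A $ p i $ i:]) * (\<Prod>i\<in>- I. ?d p i)) = 0"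
        by (simp only: mult_zero_right)
    qed
  qed
  also have "\<dots> = (\<Sum>I\<in>UNIV. \<Sum>p | p permutes I.
      ?s p * Polynomial.monom (\<Prod>i\<in>I. A $ p i $ i) (card I))"
  proof (intro sum.cong refl)
    fix I :: "'w set" and p assume "p \<in> {p. p permutes I}"
    then have "(\<Prod>i\<in>- I. ?d p i) = (\<Prod>i\<in>- I. 1)"
      by (intro prod.cong) (auto simp: permutes_not_in one_pCons)
    then show "?s p * ((\<Prod>i\<in>I. [:0, A $ p i $ i:]) * (\<Prod>i\<in>- I. ?d p i)) =
        ?s p * Polynomial.monom (\<Prod>i\<in>I. A $ p i $ i) (card I)"
      by (simp only: monom_prod prod.neutral_const mult_1_right)
  qed
  also have "\<dots> = (\<Sum>I\<in>UNIV. Polynomial.monom (principal_minor A I) (card I))"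
    by (simp add: principal_minor_def monom_sum of_int_poly smult_monom)
  finally show ?thesis
    by (simp add: trace_exterior_power coeff_sum Polynomial.coeff_monom sum.If_cases)
qed

lemma scalar_matrix_mult: "(mat c ** A) $ i $ k = c * (A $ i $ k)"
  "(A ** mat c) $ i $ k = A $ i $ k * (c :: 'a::comm_ring_1)"
  by (simp_all add: matrix_matrix_mult_def mat_def if_distrib[where f = "\<lambda>x. x * _"]
      if_distrib[where f = "\<lambda>x. _ * x"] cong: if_cong)

text \<open>The entries lie in a general commutative ring, so eigenvalues are avoided: conjugation
  passes to \<open>I + t A\<close>, because \<open>t I\<close> is central and
  \<open>B ** C = mat 1\<close>, and the determinant is multiplicative.\<close>

lemma trace_exterior_power_conjugate:
  fixes A B C :: "'a::comm_ring_1^'w^'w::finite"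
  assumes "B ** C = mat 1"
  shows "trace (exterior_power j (B ** A ** C)) = trace (exterior_power j A)"
proof -
  define k where "k = (\<lambda>M :: 'a^'w^'w. \<chi> i l. [:M $ i $ l:])"
  have k_mult: "k (M ** N) = k M ** k N" for M N
    unfolding k_def by (rule hom_matrix_mult[OF is_ring_hom_pCons])
  have k1: "k (mat 1) = mat 1"
    by (simp add: k_def mat_def vec_eq_iff one_pCons)
  let ?X = "mat [:0, 1:] :: 'a poly^'w^'w"
  have X: "?X ** M = M ** ?X" for M
    by (simp add: vec_eq_iff scalar_matrix_mult mult.commute)
  have char: "char_matrix M = mat 1 + ?X ** k M" for M
    by (simp add: vec_eq_iff scalar_matrix_mult) (simp add: char_matrix_def mat_def k_def one_pCons)
  have distrib: "k B ** (M + N) ** k C = k B ** M ** k C + k B ** N ** k C" for M N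
    by (simp add: vec_eq_iff matrix_matrix_mult_def sum.distrib distrib_left distrib_right)
  have BC: "k B ** k C = mat 1"
    using assms k_mult[of B C] by (simp add: k1)
  have "char_matrix (B ** A ** C) = k B ** k C + k B ** ?X ** k A ** k C"
    by (simp only: char k_mult BC matrix_mul_assoc X)
  also have "\<dots> = k B ** char_matrix A ** k C"
    by (simp only: char distrib matrix_mul_rid matrix_mul_assoc)
  finally have "char_matrix (B ** A ** C) = k B ** char_matrix A ** k C" .
  then have "det (char_matrix (B ** A ** C)) = det (k B ** k C) * det (char_matrix A)"
    by (simp add: det_mul mult_ac)
  then show ?thesis
    by (simp add: BC flip: coeff_det_char_matrix)
qed

lemma trace_exterior_power_uminus:
  fixes A :: "'a::comm_ring_1^'w^'w::finite"
  shows "trace (exterior_power j (- A)) = (- 1) ^ j * trace (exterior_power j A)"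
proof -
  have "(\<Prod>k<j. - c k) = (- 1) ^ j * (\<Prod>k<j. c k)" for c :: "nat \<Rightarrow> 'a"
    by (induction j) simp_all
  then have "exterior_power j (- A) $ I $ I = (- 1) ^ j * exterior_power j A $ I $ I" for I
    by (simp add: exterior_power_def sum_distrib_left mult_ac)
  then show ?thesis
    by (simp add: trace_def sum_distrib_left)
qed

section \<open>Homogeneity\<close>

lemma mdeg_superset:
  assumes "finite K" "Poly_Mapping.keys m \<subseteq> K"
  shows "mdeg m = (\<Sum>v\<in>K. Poly_Mapping.lookup m v)"
  unfolding mdeg_def by (rule sum.mono_neutral_left) (use assms in \<open>auto simp: in_keys_iff\<close>)

lemma mdeg_0 [simp]: "mdeg 0 = 0"
  by (simp add: mdeg_def)

lemma mdeg_single [simp]: "mdeg (Poly_Mapping.single v k) = k"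
  by (simp add: mdeg_def)

lemma mdeg_add: "mdeg (k + m) = mdeg k + mdeg m"
proof -
  define K where "K = Poly_Mapping.keys k \<union> Poly_Mapping.keys m"
  have "finite K" "Poly_Mapping.keys k \<subseteq> K" "Poly_Mapping.keys m \<subseteq> K" "Poly_Mapping.keys (k + m) \<subseteq> K"
    using Poly_Mapping.keys_add[of k m] by (auto simp: K_def)
  then show ?thesis
    by (simp add: mdeg_superset[of K] lookup_add sum.distrib)
qed

lemma finite_mdeg_le: "finite {m :: 'v::finite monomial. mdeg m \<le> d}"
proof -
  have "{m :: 'v monomial. mdeg m \<le> d} \<subseteq> Poly_Mapping.lookup -` (PiE UNIV (\<lambda>_. {..d}))"
  proof
    fix m :: "'v monomial" assume "m \<in> {m. mdeg m \<le> d}"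
    then have "Poly_Mapping.lookup m v \<le> d" for v
      using member_le_sum[of v UNIV "Poly_Mapping.lookup m"] by (simp add: mdeg_superset[of UNIV])
    then show "m \<in> Poly_Mapping.lookup -` (PiE UNIV (\<lambda>_. {..d}))"
      by auto
  qed
  moreover have "finite (Poly_Mapping.lookup -` (PiE UNIV (\<lambda>_. {..d})) :: 'v monomial set)"
    by (intro finite_vimageI finite_PiE) (auto intro!: injI poly_mapping_eqI)
  ultimately show ?thesis
    by (rule finite_subset)
qed

lemma homogI: "(\<And>m. Poly_Mapping.lookup P m \<noteq> 0 \<Longrightarrow> mdeg m = d) \<Longrightarrow> P \<in> homog d"
  and homogD: "P \<in> homog d \<Longrightarrow> Poly_Mapping.lookup P m \<noteq> 0 \<Longrightarrow> mdeg m = d"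
  by (auto simp: homog_def in_keys_iff)

lemma homog_0 [simp]: "0 \<in> homog d"
  by (simp add: homog_def)

lemma homog_add: "P \<in> homog d \<Longrightarrow> P' \<in> homog d \<Longrightarrow> P + P' \<in> homog d"
  using Poly_Mapping.keys_add[of P P'] by (auto simp: homog_def)

lemma homog_sum: "(\<And>s. s \<in> S \<Longrightarrow> g s \<in> homog d) \<Longrightarrow> sum g S \<in> homog d"
  by (induction S rule: infinite_finite_induct) (auto intro: homog_add)

lemma homog_mult: "P \<in> homog d \<Longrightarrow> P' \<in> homog d' \<Longrightarrow> P * P' \<in> homog (d + d')"
  using Poly_Mapping.keys_mult[of P P'] by (fastforce simp: homog_def mdeg_add)

lemma homog_const: "const c \<in> homog 0"
  by (auto simp: homog_def const_def)

lemma homog_1: "1 \<in> homog 0"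
  by (auto simp: homog_def)

lemma homog_const_mult: "P \<in> homog d \<Longrightarrow> const c * P \<in> homog d"
  using homog_mult[OF homog_const] by fastforce

lemma homog_scale: "P \<in> homog d \<Longrightarrow> scale c P \<in> homog d"
  by (simp add: scale_def homog_const_mult)

lemma homog_monom: "monom m \<in> homog (mdeg m)"
  by (simp add: homog_def monom_def)

lemma homog_var: "var v \<in> homog 1"
  using homog_monom[of "Poly_Mapping.single v 1"] by (simp add: var_def)

lemma homog_of_int: "of_int c \<in> homog 0"
  using homog_const[of "of_int c"] by (simp add: hom_of_int[OF is_ring_hom_const])

lemma homog_prod: "(\<And>s. s \<in> S \<Longrightarrow> g s \<in> homog (d s)) \<Longrightarrow> prod g S \<in> homog (sum d S)"
  by (induction S rule: infinite_finite_induct) (auto intro: homog_1 homog_mult)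

lemma homog_power: "P \<in> homog d \<Longrightarrow> P ^ k \<in> homog (k * d)"
  by (induction k) (auto intro: homog_1 homog_mult)

lemma homog_partial: "P \<in> homog d \<Longrightarrow> partial v P \<in> homog (d - 1)"
  by (rule homogI) (auto simp: lookup_partial mdeg_add dest: homogD)

text \<open>A set of admissible degrees covers two uses: \<open>{d}\<close> for homogeneous forms,
  and \<open>{..K}\<close> for a quotient of which only a degree bound is known.\<close>

lemma mdeg_substitute:
  assumes x: "\<And>v. x v \<in> homog 1"
    and D: "\<And>m. m \<in> Poly_Mapping.keys P \<Longrightarrow> mdeg m \<in> D"
    and k: "k \<in> Poly_Mapping.keys (substitute x P)"
  shows "mdeg k \<in> D"
proof -
  let ?t = "\<lambda>m. const (Poly_Mapping.lookup P m) *
    (\<Prod>v\<in>Poly_Mapping.keys m. x v ^ Poly_Mapping.lookup m v)"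
  have "(\<Prod>v\<in>Poly_Mapping.keys m. x v ^ Poly_Mapping.lookup m v) \<in> homog (mdeg m)" for m
    unfolding mdeg_def using homog_power[OF x] by (intro homog_prod) simp
  then have t: "?t m \<in> homog (mdeg m)" for m
    by (rule homog_const_mult)
  have "k \<in> Poly_Mapping.keys (\<Sum>m\<in>Poly_Mapping.keys P. ?t m)"
    using k by (simp add: substitute_def eval_with_def)
  then obtain m where "m \<in> Poly_Mapping.keys P" "k \<in> Poly_Mapping.keys (?t m)"
    using Poly_Mapping.keys_sum[of ?t "Poly_Mapping.keys P"] by blast
  then show ?thesis
    using t[of m] D[of m] by (simp add: homog_def)
qed

lemma homog_substitute:
  "(\<And>v. x v \<in> homog 1) \<Longrightarrow> P \<in> homog d \<Longrightarrow> substitute x P \<in> homog d"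
  using mdeg_substitute[of x P "{d}"] by (auto simp: homog_def)

lemma homog_det:
  assumes "\<And>i j. A $ i $ j \<in> homog d"
  shows "det (A :: 'v cpoly^'n^'n) \<in> homog (CARD('n) * d)"
proof -
  have "(\<Prod>i\<in>UNIV. A $ i $ p i) \<in> homog (CARD('n) * d)" for p
    using homog_prod[of UNIV "\<lambda>i. A $ i $ p i" "\<lambda>_. d"] assms by simp
  then show ?thesis
    unfolding det_def by (intro homog_sum) (metis homog_mult homog_of_int add_0)
qed

lemma homog_det_poly: "(det_poly :: ('n::finite \<times> 'n) cpoly) \<in> homog CARD('n)"
proof -
  have "det ((\<chi> i j. var (i, j)) :: ('n \<times> 'n) cpoly^'n^'n) \<in> homog (CARD('n) * 1)"
    by (rule homog_det) (simp add: homog_var del: One_nat_def)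
  then show ?thesis
    by (simp add: det_poly_def)
qed

lemma homog_trace_exterior_power:
  assumes "\<And>p q. A $ p $ q \<in> homog d"
  shows "trace (exterior_power j A) \<in> homog (j * d)"
proof -
  have "(\<Prod>k<j. A $ \<alpha> k $ \<beta> k) \<in> homog (j * d)" for \<alpha> \<beta>
    using homog_prod[of "{..<j}" "\<lambda>k. A $ \<alpha> k $ \<beta> k" "\<lambda>_. d"] assms by simp
  then have "of_int c * (\<Prod>k<j. A $ \<alpha> k $ \<beta> k) \<in> homog (j * d)" for c \<alpha> \<beta>
    by (metis homog_mult homog_of_int add_0)
  then show ?thesis
    unfolding trace_def exterior_power_def by (auto intro!: homog_sum)
qed

lemma homog_hessian: "P \<in> homog d \<Longrightarrow> hessian P $ p $ q \<in> homog (d - 2)"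
  using homog_partial[OF homog_partial, of P d p q] by (simp add: hessian_def numeral_2_eq_2)

section \<open>The orthogonal group\<close>

definition entry :: "complex^'n^'n \<Rightarrow> 'n \<times> 'n \<Rightarrow> complex"
  where "entry A q = A $ fst q $ snd q"

lemma entry_add: "entry (A + B) q = entry A q + entry B q"
  and entry_scale: "entry (matrix_scale c A) q = c * entry A q"
  and entry_unit: "entry (matrix_unit p) q = (if q = p then 1 else 0)"
  by (simp_all add: entry_def matrix_scale_def matrix_unit_def)

lemma entry_sum: "entry (sum f S) q = (\<Sum>s\<in>S. entry (f s) q)"
  by (induction S rule: infinite_finite_induct) (simp_all add: entry_add, simp_all add: entry_def)

lemma entry_eqI: "(\<And>q. entry A q = entry B q) \<Longrightarrow> A = B"
  by (simp add: entry_def vec_eq_iff split_paired_all)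

lemma sum_pairs: "(\<Sum>q\<in>UNIV. f (fst q) (snd q)) = (\<Sum>i\<in>UNIV. \<Sum>j\<in>UNIV. f i j)"
  by (simp add: sum.cartesian_product case_prod_unfold)

lemma Q_eq: "Q A = (\<Sum>q\<in>UNIV. entry A q * entry A q)"
  unfolding entry_def
  by (subst sum_pairs) (simp add: Q_def trace_def matrix_matrix_mult_def transpose_def)

lemma linear_form_eq: "linear_form A = (\<Sum>q\<in>UNIV. const (entry A q) * var q)"
  by (simp add: linear_form_def scale_def entry_def case_prod_unfold)

lemma matrix_eq_sum_units:
  "(A :: complex^'n::finite^'n) = (\<Sum>p\<in>UNIV. matrix_scale (entry A p) (matrix_unit p))"
  by (rule entry_eqI)
    (simp add: entry_sum entry_scale entry_unit if_distrib[where f = "\<lambda>x. _ * x"] cong: if_cong)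

lemma is_ring_hom_act: "is_ring_hom (act g)"
  unfolding act_def by (rule is_ring_hom_substitute)

lemma act_const: "act g (const c) = const c"
  and act_var: "act g (var p) = linear_form (g (matrix_unit p))"
  by (simp_all add: act_def)

lemma partial_linear_form: "partial q (linear_form A) = const (entry A q)"
  by (simp add: linear_form_eq partial_sum partial_const_mult partial_var
      if_distrib[where f = "\<lambda>x. _ * x"] cong: if_cong)

lemma homog_linear_form: "linear_form A \<in> homog 1"
  by (unfold linear_form_eq, intro homog_sum homog_const_mult homog_var)

lemma homog_act: "P \<in> homog d \<Longrightarrow> act g P \<in> homog d"
  unfolding act_def by (intro homog_substitute homog_linear_form)

section \<open>The Hessian under linear and orthogonal substitutions\<close>

definition coord_matrix ::
    "(complex^'n^'n \<Rightarrow> complex^'n^'n) \<Rightarrow> complex^('n \<times> 'n)^('n \<times> 'n)"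
  where "coord_matrix g = (\<chi> q p. entry (g (matrix_unit p)) q)"

lemma partial_act:
  "partial q (act g P) = (\<Sum>p\<in>UNIV. const (coord_matrix g $ q $ p) * act g (partial p P))"
  unfolding act_def substitute_def
  by (subst derivation_chain_rule[where d = "partial q"])
    (simp_all add: is_ring_hom_const partial_add partial_mult partial_linear_form coord_matrix_def)

text \<open>The coordinate matrix is constant, so differentiating twice yields no first-order terms
  and the Hessian transforms like a quadratic form. For orthogonal \<open>g\<close> this congruence
  is a conjugation.\<close>

lemma hessian_act:
  fixes g :: "complex^'n::finite^'n \<Rightarrow> complex^'n^'n"
  defines "G \<equiv> (\<chi> q p. const (coord_matrix g $ q $ p))"
  shows "hessian (act g P) = G ** (\<chi> p q. act g (hessian P $ p $ q)) ** transpose G"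
proof -
  have "partial r (partial q (act g P)) = (\<Sum>p\<in>UNIV.
      (\<Sum>s\<in>UNIV. const (coord_matrix g $ r $ s) * act g (partial s (partial p P))) *
      const (coord_matrix g $ q $ p))" for q r
    by (simp add: partial_act partial_sum partial_const_mult mult.commute[of "const _" "sum _ _"])
  then show ?thesis
    by (simp add: vec_eq_iff hessian_def G_def matrix_matrix_mult_def transpose_def)
qed

lemma vector_space_matrix_scale: "vector_space (matrix_scale :: complex \<Rightarrow> complex^'n^'n \<Rightarrow> _)"
  by unfold_locales (simp_all add: matrix_scale_def vec_eq_iff algebra_simps)

lemma orth_groupI:
  assumes "\<And>A B. g (A + B) = g A + g B" "\<And>c A. g (matrix_scale c A) = matrix_scale c (g A)"
    "bij g" "\<And>A. Q (g A) = Q A"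
  shows "g \<in> orth_group"
  using assms by (simp add: orth_group_def Vector_Spaces.linear_iff vector_space_matrix_scale)

context
  fixes g :: "complex^'n::finite^'n \<Rightarrow> complex^'n^'n"
  assumes g: "g \<in> orth_group"
begin

lemma orth_group_add: "g (A + B) = g A + g B"
  and orth_group_scale: "g (matrix_scale c A) = matrix_scale c (g A)"
  and orth_group_bij: "bij g"
  and orth_group_Q: "Q (g A) = Q A"
  using g by (simp_all add: orth_group_def Vector_Spaces.linear_iff)

lemma orth_group_sum: "g (sum f S) = (\<Sum>s\<in>S. g (f s))"
proof -
  have "g 0 = 0"
    using orth_group_add[of 0 0] by simp
  then show ?thesis
    by (induction S rule: infinite_finite_induct) (simp_all add: orth_group_add)
qed

lemma entry_orth_group:
  "entry (g A) q = (\<Sum>p\<in>UNIV. entry A p * entry (g (matrix_unit p)) q)"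
  by (subst matrix_eq_sum_units[of A]) (simp add: orth_group_sum orth_group_scale entry_sum entry_scale)

lemma orth_group_inner:
  "(\<Sum>q\<in>UNIV. entry (g A) q * entry (g B) q) = (\<Sum>q\<in>UNIV. entry A q * entry B q)"
proof -
  \<comment> \<open>Polarization recovers the bilinear form from \<open>Q\<close>.\<close>
  have "Q (A + B) - Q A - Q B = 2 * (\<Sum>q\<in>UNIV. entry A q * entry B q)" for A B :: "complex^'n^'n"
    by (simp add: Q_eq entry_add distrib_left distrib_right sum.distrib mult.commute sum_distrib_left)
  from this[of A B] this[of "g A" "g B"] show ?thesis
    by (simp add: orth_group_Q flip: orth_group_add)
qed

lemma coord_matrix_orthogonal:
  "coord_matrix g ** transpose (coord_matrix g) = mat 1" "transpose (coord_matrix g) ** coord_matrix g = mat 1"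
proof -
  show "transpose (coord_matrix g) ** coord_matrix g = mat 1"
    by (simp add: vec_eq_iff matrix_matrix_mult_def transpose_def coord_matrix_def orth_group_inner
        entry_unit mat_def if_distrib[where f = "\<lambda>x. _ * x"] cong: if_cong)
  then show "coord_matrix g ** transpose (coord_matrix g) = mat 1"
    by (rule matrix_left_right_inverse[THEN iffD1])
qed

text \<open>A left inverse is turned into a two-sided one over the field of complex numbers, and
  both identities are then carried to the polynomial ring by \<open>const\<close>.\<close>

lemma hessian_act_orthogonal:
  defines "G \<equiv> (\<chi> q p. const (coord_matrix g $ q $ p))"
  shows "G ** transpose G = mat 1" "transpose G ** G = mat 1"
proof -
  have G: "transpose G = (\<chi> q p. const (transpose (coord_matrix g) $ q $ p))"
    by (simp add: G_def transpose_def vec_eq_iff)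
  have "(\<chi> q p. const (mat 1 $ q $ p)) = mat 1"
    by (simp add: mat_def vec_eq_iff hom_0[OF is_ring_hom_const] hom_1[OF is_ring_hom_const])
  then show "G ** transpose G = mat 1" "transpose G ** G = mat 1"
    unfolding G unfolding G_def hom_matrix_mult[OF is_ring_hom_const, symmetric]
    by (simp_all only: coord_matrix_orthogonal)
qed

lemma trace_exterior_power_hessian_act:
  "trace (exterior_power j (hessian (act g P))) = act g (trace (exterior_power j (hessian P)))"
  unfolding hessian_act
  by (simp add: trace_exterior_power_conjugate[OF hessian_act_orthogonal(1)]
      hom_trace_exterior_power[OF is_ring_hom_act])

lemma trace_hessian_act: "trace (hessian (act g P)) = act g (trace (hessian P))"
proof -
  let ?G = "\<chi> q p. const (coord_matrix g $ q $ p)"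
  let ?M = "\<chi> p q. act g (hessian P $ p $ q)"
  have "trace (?G ** ?M ** transpose ?G) = trace ?M"
    by (subst trace_mul_sym) (simp add: matrix_mul_assoc hessian_act_orthogonal(2))
  then show ?thesis
    by (simp add: hessian_act hom_trace[OF is_ring_hom_act])
qed

lemma act_linear_form: "act g (linear_form A) = linear_form (g A)"
proof -
  have "act g (linear_form A) =
      (\<Sum>p\<in>UNIV. const (entry A p) * (\<Sum>q\<in>UNIV. const (entry (g (matrix_unit p)) q) * var q))"
    by (simp add: linear_form_eq hom_sum[OF is_ring_hom_act] hom_mult[OF is_ring_hom_act] act_const act_var)
  also have "\<dots> = (\<Sum>q\<in>UNIV. const (entry (g A) q) * var q)"
    by (subst entry_orth_group) (simp add: sum_distrib_left sum_distrib_right hom_sum[OF is_ring_hom_const]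
        hom_mult[OF is_ring_hom_const] mult.assoc, rule sum.swap)
  finally show ?thesis
    by (simp add: linear_form_eq)
qed

lemma orth_group_inv: "inv g \<in> orth_group"
proof (rule orth_groupI)
  have [simp]: "g (inv g A) = A" "inv g (g A) = A" for A
    using orth_group_bij by (simp_all add: bij_is_surj surj_f_inv_f bij_is_inj)
  have eqI: "g A = g B \<Longrightarrow> A = B" for A B
    using orth_group_bij by (simp add: bij_is_inj inj_eq)
  show "inv g (A + B) = inv g A + inv g B" for A B
    by (rule eqI) (simp add: orth_group_add)
  show "inv g (matrix_scale c A) = matrix_scale c (inv g A)" for c A
    by (rule eqI) (simp add: orth_group_scale)
  show "bij (inv g)"
    using orth_group_bij by (rule bij_imp_bij_inv)
  show "Q (inv g A) = Q A" for A
    using orth_group_Q[of "inv g A"] by simp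
qed

end

lemma orth_group_comp: "f \<in> orth_group \<Longrightarrow> g \<in> orth_group \<Longrightarrow> f \<circ> g \<in> orth_group"
  by (rule orth_groupI) (simp_all add: orth_group_add orth_group_scale orth_group_Q orth_group_bij bij_comp)

lemma act_comp:
  assumes "f \<in> orth_group"
  shows "act f (act g P) = act (f \<circ> g) P"
proof -
  have "act f (act g P) = substitute (\<lambda>p. act f (linear_form (g (matrix_unit p)))) P"
    by (simp add: act_def substitute_substitute)
  then show ?thesis
    by (simp add: act_linear_form[OF assms]) (simp add: act_def)
qed

lemma act_id: "act id P = P"
proof -
  have "linear_form (matrix_unit p) = var p" for p :: "'a \<times> 'a"
    by (simp add: linear_form_eq entry_unit if_distrib[where f = const]
        hom_0[OF is_ring_hom_const] hom_1[OF is_ring_hom_const]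
        if_distrib[where f = "\<lambda>x. x * _"] cong: if_cong)
  then show ?thesis
    by (simp add: act_def substitute_vars)
qed

lemma act_inv_act: "g \<in> orth_group \<Longrightarrow> act (inv g) (act g P) = P"
  by (simp add: act_comp orth_group_inv orth_group_bij bij_is_inj act_id)

section \<open>The Hessian of the determinant at singular matrices\<close>

text \<open>A Leibniz term takes one variable from each row, so it has degree at most one in every
  variable. The second conjunct makes the induction go through: a variable from a row not yet
  multiplied in does not occur. Harmonicity of the determinant follows.\<close>

lemma partial_partial_prod_vars:
  assumes "finite I"
  shows "partial p (partial p (\<Prod>i\<in>I. var (i, \<sigma> i))) = 0 \<and>
    (fst p \<notin> I \<longrightarrow> partial p (\<Prod>i\<in>I. var (i, \<sigma> i)) = 0)"
proof -
  have 0: "partial q 0 = 0" and 1: "partial q 1 = 0" for q :: "'a \<times> 'b"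
    using partial_const[of q 0] partial_const[of q 1] by (simp_all add: const_def)
  have 2: "partial p (partial p (var q)) = 0" for q
    by (simp add: partial_var 0 1)
  show ?thesis
    using assms
  proof (induction I rule: finite_induct)
    case (insert i I)
    then have "partial p (var (i, \<sigma> i)) * partial p (\<Prod>i\<in>I. var (i, \<sigma> i)) = 0"
      by (auto simp: partial_var)
    with insert show ?case
      by (simp add: partial_mult partial_add 2) (auto simp: partial_var)
  qed (simp add: 0 1)
qed

lemma trace_hessian_det_poly: "trace (hessian (det_poly :: ('n::finite \<times> 'n) cpoly)) = 0"
proof -
  have "partial p (of_int c * P) = of_int c * partial p P" for p c and P :: "('n \<times> 'n) cpoly"
    using partial_const_mult[of p "of_int c"] by (simp add: hom_of_int[OF is_ring_hom_const])
  then have "partial p (partial p det_poly) = 0" for p :: "'n \<times> 'n"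
    by (simp add: det_poly_def det_def partial_sum partial_partial_prod_vars)
  then show ?thesis
    by (simp add: trace_def hessian_def)
qed

section \<open>Left multiplication by orthogonal matrices, and reflections\<close>

lemma matrix_mult_orth_group:
  fixes S :: "complex^'n::finite^'n"
  assumes S: "transpose S ** S = mat 1"
  shows "(\<lambda>A. S ** A) \<in> orth_group"
proof (rule orth_groupI)
  have S': "S ** transpose S = mat 1"
    using S by (rule matrix_left_right_inverse[THEN iffD1])
  show "S ** (A + B) = S ** A + S ** B" for A B
    by (simp add: matrix_add_ldistrib)
  show "S ** matrix_scale c A = matrix_scale c (S ** A)" for c A
    by (simp add: vec_eq_iff matrix_matrix_mult_def matrix_scale_def sum_distrib_left mult_ac)
  show "bij (\<lambda>A. S ** A)"
    by (rule o_bij[of "\<lambda>A. transpose S ** A"]) (simp_all add: fun_eq_iff matrix_mul_assoc S S')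
  show "Q (S ** A) = Q A" for A
  proof -
    have "Q (S ** A) = trace (S ** (A ** transpose (S ** A)))"
      by (simp add: Q_def matrix_mul_assoc)
    also have "\<dots> = trace (A ** transpose A ** (transpose S ** S))"
      by (subst trace_mul_sym) (simp add: matrix_transpose_mul matrix_mul_assoc)
    finally show ?thesis
      by (simp add: S Q_def)
  qed
qed

text \<open>Variables are basis vectors of \<open>W\<close>, not coordinate functions. The generic
  matrix is therefore multiplied by the transpose of \<open>S\<close>, which explains the transposes
  in the lemmas that follow.\<close>

lemma act_matrix_mult_var:
  fixes S :: "complex^'n::finite^'n"
  shows "act (\<lambda>A. S ** A) (var (k, l)) = (\<Sum>i\<in>UNIV. const (S $ i $ k) * var (i, l))"
proof -
  have "entry (S ** matrix_unit (k, l)) (i, j) = (if j = l then S $ i $ k else 0)" for i j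
    by (simp add: entry_def matrix_matrix_mult_def matrix_unit_def
        if_distrib[where f = "\<lambda>x. _ * x"] cong: if_cong)
  then have "linear_form (S ** matrix_unit (k, l)) =
      (\<Sum>q\<in>UNIV. (if snd q = l then const (S $ fst q $ k) else 0) * var (fst q, snd q))"
    unfolding linear_form_eq
    by (intro sum.cong) (auto simp: split_paired_all hom_0[OF is_ring_hom_const])
  also have "\<dots> = (\<Sum>i\<in>UNIV. \<Sum>j\<in>UNIV. (if j = l then const (S $ i $ k) else 0) * var (i, j))"
    by (rule sum_pairs)
  also have "\<dots> = (\<Sum>i\<in>UNIV. const (S $ i $ k) * var (i, l))"
    by (simp add: if_distrib[where f = "\<lambda>x. x * _"] cong: if_cong)
  finally show ?thesis
    by (simp add: act_def)
qed

lemma transpose_matrix_mult: "transpose A ** B = (\<chi> i j. \<Sum>k\<in>UNIV. A $ k $ i * B $ k $ j)"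
  by (simp add: transpose_def matrix_matrix_mult_def)

lemma act_matrix_mult_det_poly:
  fixes S :: "complex^'n::finite^'n"
  shows "act (\<lambda>A. S ** A) det_poly = const (det S) * det_poly"
proof -
  let ?X = "(\<chi> i j. var (i, j)) :: ('n \<times> 'n) cpoly^'n^'n"
  have "act (\<lambda>A. S ** A) det_poly = det (transpose (\<chi> i j. const (S $ i $ j)) ** ?X)"
    by (simp add: det_poly_def hom_det[OF is_ring_hom_act] act_matrix_mult_var transpose_matrix_mult)
  then show ?thesis
    by (simp add: det_mul det_transpose hom_det[OF is_ring_hom_const] det_poly_def)
qed

lemma evaluate_act_matrix_mult:
  fixes S X :: "complex^'n::finite^'n"
  shows "evaluate (entry X) (act (\<lambda>A. S ** A) P) = evaluate (entry (transpose S ** X)) P"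
proof (rule ring_hom_eqI[where P = P])
  show "is_ring_hom (\<lambda>P. evaluate (entry X) (act (\<lambda>A. S ** A) P))"
    by (rule is_ring_hom_comp[OF is_ring_hom_evaluate is_ring_hom_act])
  show "evaluate (entry X) (act (\<lambda>A. S ** A) (var v)) = evaluate (entry (transpose S ** X)) (var v)" for v
    by (cases v) (simp add: act_matrix_mult_var hom_sum[OF is_ring_hom_evaluate]
        hom_mult[OF is_ring_hom_evaluate] entry_def transpose_matrix_mult)
  show "evaluate (entry X) (act (\<lambda>A. S ** A) (const c)) = evaluate (entry (transpose S ** X)) (const c)" for c
    by (simp add: act_const)
qed (rule is_ring_hom_evaluate)

lemma evaluate_trace_exterior_power_hessian_det_fixed:
  fixes S X :: "complex^'n::finite^'n"
  assumes S: "transpose S ** S = mat 1" "det S = - 1" and X: "transpose S ** X = X" and "odd j"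
  shows "evaluate (entry X) (trace (exterior_power j (hessian det_poly))) = 0"
proof -
  let ?g = "\<lambda>A. S ** A" and ?R = "trace (exterior_power j (hessian det_poly)) :: ('n \<times> 'n) cpoly"
  have "const (- 1) = (- 1 :: ('n \<times> 'n) cpoly)"
    by (simp add: hom_uminus[OF is_ring_hom_const] hom_1[OF is_ring_hom_const])
  then have "act ?g det_poly = - det_poly"
    by (simp add: act_matrix_mult_det_poly S)
  then have "act ?g ?R = trace (exterior_power j (hessian (- det_poly)))"
    using trace_exterior_power_hessian_act[OF matrix_mult_orth_group[OF S(1)], of j det_poly] by simp
  also have "hessian (- det_poly) = - hessian det_poly"
    by (simp add: hessian_def partial_uminus vec_eq_iff)
  finally have "act ?g ?R = - ?R"
    using \<open>odd j\<close> by (simp add: trace_exterior_power_uminus)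
  then have "evaluate (entry X) ?R = - evaluate (entry X) ?R"
    using evaluate_act_matrix_mult[of X S ?R] by (simp add: X hom_uminus[OF is_ring_hom_evaluate])
  then show ?thesis
    by simp
qed

text \<open>\<open>S\<close> is the reflection along a unit vector \<open>w\<close> in the left
  kernel of \<open>X\<close>. Writing it as a conjugate of a diagonal matrix by an orthogonal
  \<open>A\<close> whose column \<open>k\<close> is \<open>w\<close> lets symmetry, orthogonality
  and the determinant be read off from \<open>D\<close>.\<close>

lemma real_singular_matrix_fixed_by_reflection:
  fixes X :: "real^'n::finite^'n"
  assumes "det X = 0"
  obtains S where "transpose S ** S = mat 1" "det S = - 1" "transpose S ** X = X"
proof -
  obtain u where u: "u \<noteq> 0" "transpose X *v u = 0"
    using assms invertible_det_nz[of "transpose X"] matrix_left_invertible_ker[of "transpose X"]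
    by (auto simp: det_transpose invertible_left_inverse)
  define w where "w = u /\<^sub>R norm u"
  have w: "norm w = 1" "transpose X *v w = 0"
    using u by (simp_all add: w_def matrix_vector_mult_scaleR)
  fix k :: 'n
  obtain A :: "real^'n^'n" where A: "orthogonal_matrix A" "A *v axis k 1 = w"
    using orthogonal_matrix_exists_basis[OF w(1)] by blast
  define D :: "real^'n^'n" where "D = (\<chi> i j. if i = j then (if i = k then - 1 else 1) else 0)"
  define S where "S = A ** D ** transpose A"
  have AA: "transpose A ** A = mat 1" "A ** transpose A = mat 1"
    using A(1) by (simp_all add: orthogonal_matrix_def)
  have D: "transpose D = D" "D ** D = mat 1"
    by (auto simp: D_def transpose_def mat_def vec_eq_iff matrix_matrix_mult_def
        if_distrib[where f = "\<lambda>x. x * _"] cong: if_cong)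
  have S: "transpose S = S"
    by (simp add: S_def matrix_transpose_mul D matrix_mul_assoc)
  have "S ** S = A ** D ** (transpose A ** A) ** D ** transpose A"
    by (simp add: S_def matrix_mul_assoc)
  also have "\<dots> = A ** (D ** D) ** transpose A"
    unfolding AA by (simp add: matrix_mul_assoc)
  finally have "transpose S ** S = mat 1"
    unfolding S D by (simp add: AA)
  moreover have "det S = - 1"
  proof -
    have "det D = (\<Prod>i\<in>UNIV. if i = k then - 1 else 1)"
      by (subst det_diagonal) (simp_all add: D_def)
    then have "det D = - 1"
      by simp
    moreover have "det (A ** transpose A) = 1"
      by (simp add: AA)
    ultimately show ?thesis
      by (simp add: S_def det_mul)
  qed
  moreover have "transpose S ** X = X"
  proof -
    have col: "A $ i $ k = w $ i" for i
      using A(2) by (auto simp: vec_eq_iff matrix_vector_mult_def axis_def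
          if_distrib[where f = "\<lambda>x. _ * x"] cong: if_cong)
    \<comment> \<open>Row \<open>k\<close> is the only one whose sign \<open>D\<close> changes, and
      it consists of the products of \<open>w\<close> with the columns of \<open>X\<close>.\<close>
    have "(transpose A ** X) $ k $ l = 0" for l
      using w(2) by (simp add: vec_eq_iff matrix_matrix_mult_def matrix_vector_mult_def transpose_def col mult.commute)
    then have "D ** (transpose A ** X) = transpose A ** X"
      by (auto simp: vec_eq_iff D_def matrix_matrix_mult_def[of "vec_lambda _"]
          if_distrib[where f = "\<lambda>x. x * _"] cong: if_cong)
    then have "transpose S ** X = A ** (transpose A ** X)"
      unfolding S by (simp add: S_def flip: matrix_mul_assoc)
    then show ?thesis
      by (simp add: matrix_mul_assoc AA)
  qed
  ultimately show ?thesis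
    by (rule that)
qed

lemma is_ring_hom_complex_of_real: "is_ring_hom complex_of_real"
  by (simp add: is_ring_hom_def)

lemma evaluate_trace_exterior_power_hessian_det_singular:
  fixes X :: "real^'n::finite^'n"
  assumes "det X = 0" "odd j"
  shows "evaluate (\<lambda>(i, k). complex_of_real (X $ i $ k)) (trace (exterior_power j (hessian det_poly))) = 0"
proof -
  obtain S where S: "transpose S ** S = mat 1" "det S = - 1" "transpose S ** X = X"
    using real_singular_matrix_fixed_by_reflection[OF assms(1)] .
  define c where "c = (\<lambda>M :: real^'n^'n. \<chi> i k. complex_of_real (M $ i $ k))"
  have mult: "c (M ** N) = c M ** c N" for M N
    unfolding c_def by (rule hom_matrix_mult[OF is_ring_hom_complex_of_real])
  have tr: "transpose (c M) = c (transpose M)" for M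
    by (simp add: c_def transpose_def)
  have "c (mat 1) = mat 1"
    by (simp add: c_def mat_def vec_eq_iff)
  moreover have "det (c S) = - 1"
    using hom_det[OF is_ring_hom_complex_of_real, of S] S(2) by (simp add: c_def)
  ultimately have "evaluate (entry (c X)) (trace (exterior_power j (hessian det_poly))) = 0"
    using S assms(2) by (intro evaluate_trace_exterior_power_hessian_det_fixed[of "c S"])
      (simp_all add: tr flip: mult)
  then show ?thesis
    by (simp add: c_def entry_def[abs_def] case_prod_unfold)
qed

section \<open>Forms vanishing on singular matrices\<close>

text \<open>Characteristic zero: differentiating by a variable that occurs in a monomial multiplies
  its coefficient by a nonzero integer.\<close>

lemma const_if_partials_zero:
  assumes "\<And>v. partial v P = 0"
  shows "P = const (Poly_Mapping.lookup P 0)"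
proof (rule poly_mapping_eqI)
  fix m :: "'a monomial"
  have "Poly_Mapping.lookup P m = 0" if "m \<noteq> 0"
  proof -
    obtain v where v: "Poly_Mapping.lookup m v \<noteq> 0"
      using \<open>m \<noteq> 0\<close> by (metis poly_mapping_eqI lookup_zero)
    define m' where "m' = m - Poly_Mapping.single v 1"
    have m: "m = m' + Poly_Mapping.single v 1"
      using v by (intro poly_mapping_eqI)
        (auto simp: m'_def lookup_add lookup_minus lookup_single when_def)
    have "of_nat (Suc (Poly_Mapping.lookup m' v)) * Poly_Mapping.lookup P m = 0"
      using lookup_partial[of v P m'] assms[of v] m by (simp add: add.commute)
    then show ?thesis
      by (simp del: of_nat_Suc)
  qed
  then show "Poly_Mapping.lookup P m = Poly_Mapping.lookup (const (Poly_Mapping.lookup P 0)) m"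
    by (simp add: lookup_const)
qed

text \<open>Restricted to a coordinate line through a point of \<open>U\<close>, the polynomial has
  infinitely many roots, so its partial derivatives vanish on \<open>U\<close> too; induction on the
  degree finishes. The hypothesis on lines suits a set of real points, which is not open in the
  complex space.\<close>

lemma cpoly_eq_0_if_vanishes:
  fixes P :: "'v::finite cpoly" and U :: "('v \<Rightarrow> complex) set"
  assumes "U \<noteq> {}" and U: "\<And>y v. y \<in> U \<Longrightarrow> infinite {t. y(v := t) \<in> U}"
    and "\<And>y. y \<in> U \<Longrightarrow> evaluate y P = 0"
  shows "P = 0"
proof -
  have partial_vanishes: "evaluate y (partial v P) = 0"
    if y: "y \<in> U" and P: "\<And>y. y \<in> U \<Longrightarrow> evaluate y P = 0" for y v and P :: "'v cpoly"
  proof -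
    \<comment> \<open>The coordinate line through \<open>y\<close> in direction \<open>v\<close>.
      Only coordinate \<open>v\<close> depends on the parameter, so the chain rule leaves just
      \<open>partial v P\<close>.\<close>
    define x where "x = (\<lambda>w. if w = v then [:0, 1:] else [:y w:])"
    define f where "f = eval_with (\<lambda>c. [:c:]) x"
    have f: "is_ring_hom f"
      unfolding f_def by (rule is_ring_hom_eval_with[OF is_ring_hom_pCons])
    have poly_f: "poly (f P) t = evaluate (y(v := t)) P" for t P
      by (rule ring_hom_eqI[where P = P, OF is_ring_hom_comp[OF is_ring_hom_poly f] is_ring_hom_evaluate])
        (simp_all add: f_def is_ring_hom_pCons x_def)
    have "infinite {t. poly (f P) t = 0}"
      using U[OF y, of v] by (rule infinite_super[rotated]) (auto simp: poly_f P)
    then have "f P = 0"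
      using poly_roots_finite by blast
    moreover have "pderiv (f P) = (\<Sum>w\<in>UNIV. pderiv (x w) * f (partial w P))"
      unfolding f_def
      by (rule derivation_chain_rule[OF is_ring_hom_pCons])
        (simp_all add: pderiv_add pderiv_mult pderiv_pCons mult.commute)
    moreover have "(\<Sum>w\<in>UNIV. pderiv (x w) * f (partial w P)) = (\<Sum>w\<in>UNIV. if w = v then f (partial w P) else 0)"
      by (intro sum.cong) (simp_all add: x_def pderiv_pCons)
    ultimately have "f (partial v P) = 0"
      by simp
    then show ?thesis
      using poly_f[of "partial v P" "y v"] by simp
  qed
  have "P = 0"
    if "\<And>m. Poly_Mapping.lookup P m \<noteq> 0 \<Longrightarrow> mdeg m \<le> k" "\<And>y. y \<in> U \<Longrightarrow> evaluate y P = 0"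
    for k and P :: "'v cpoly"
    using that
  proof (induction k arbitrary: P)
    case 0
    have "partial v P = 0" for v
      using 0(1)[of "_ + Poly_Mapping.single v 1"]
      by (intro poly_mapping_eqI) (auto simp: lookup_partial mdeg_add)
    then have "P = const (Poly_Mapping.lookup P 0)"
      by (rule const_if_partials_zero)
    with 0(2) \<open>U \<noteq> {}\<close> show ?case
      by (metis evaluate_const ex_in_conv hom_0 is_ring_hom_const)
  next
    case (Suc k)
    have "partial v P = 0" for v
    proof (rule Suc.IH)
      show "mdeg m \<le> k" if "Poly_Mapping.lookup (partial v P) m \<noteq> 0" for m
        using Suc.prems(1)[of "m + Poly_Mapping.single v 1"] that
        by (auto simp: lookup_partial mdeg_add)
      show "evaluate y (partial v P) = 0" if "y \<in> U" for y
        using that Suc.prems(2) by (rule partial_vanishes)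
    qed
    then have "P = const (Poly_Mapping.lookup P 0)"
      by (rule const_if_partials_zero)
    with Suc.prems(2) \<open>U \<noteq> {}\<close> show ?case
      by (metis evaluate_const ex_in_conv hom_0 is_ring_hom_const)
  qed
  moreover have "mdeg m \<le> (\<Sum>m\<in>Poly_Mapping.keys P. mdeg m)" if "Poly_Mapping.lookup P m \<noteq> 0" for m
    using that by (intro member_le_sum) (simp_all add: in_keys_iff)
  ultimately show ?thesis
    using assms(3) by blast
qed

text \<open>The coefficient ring will be a polynomial ring, so monicity replaces division by a
  leading coefficient. The bound on the remainder is put on coefficients because in this form it
  survives specializing them.\<close>

lemma monic_division:
  fixes f g :: "'a::comm_ring_1 poly"
  assumes "poly.coeff f n = 1" "\<And>i. i > n \<Longrightarrow> poly.coeff f i = 0"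
  obtains q r where "g = f * q + r" "\<And>i. i \<ge> n \<Longrightarrow> poly.coeff r i = 0"
proof -
  have "\<exists>q r. g = f * q + r \<and> (\<forall>i\<ge>n. poly.coeff r i = 0)" if "\<forall>i\<ge>n + k. poly.coeff g i = 0" for k
    using that
  proof (induction k arbitrary: g)
    case 0
    then show ?case
      by (intro exI[of _ 0] exI[of _ g]) simp
  next
    case (Suc k)
    \<comment> \<open>The multiple of \<open>f\<close> that cancels the top coefficient of
      \<open>g\<close>, lowering the excess \<open>k\<close> by one.\<close>
    define a where "a = Polynomial.monom (poly.coeff g (n + k)) k"
    have "poly.coeff (g - a * f) i = 0" if "i \<ge> n + k" for i
      using that assms Suc.prems by (cases "i = n + k") (simp_all add: a_def coeff_monom_mult)
    then obtain q r where "g - a * f = f * q + r" "\<forall>i\<ge>n. poly.coeff r i = 0"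
      using Suc.IH[of "g - a * f"] by blast
    then show ?case
      by (intro exI[of _ "a + q"] exI[of _ r]) (simp add: algebra_simps)
  qed
  moreover have "\<forall>i\<ge>n + Suc (degree g). poly.coeff g i = 0"
    by (simp add: coeff_eq_0)
  ultimately show ?thesis
    using that by blast
qed

lemma coeff_prod_linear:
  fixes a b :: "'i \<Rightarrow> 'a::comm_ring_1"
  assumes "finite I"
  shows "poly.coeff (\<Prod>i\<in>I. [:a i, b i:]) (card I) = (\<Prod>i\<in>I. b i) \<and>
    (\<forall>k>card I. poly.coeff (\<Prod>i\<in>I. [:a i, b i:]) k = 0)"
  using assms
proof (induction I rule: finite_induct)
  case (insert i I)
  have "poly.coeff ([:a i, b i:] * p) (Suc k) = a i * poly.coeff p (Suc k) + b i * poly.coeff p k"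
    for p :: "'a poly" and k
    by simp
  then show ?case
    using insert by (auto simp: gr0_conv_Suc dest!: less_imp_Suc_add)
qed (auto simp: gr0_conv_Suc)

text \<open>The top coefficient of a Leibniz term is the product of the slopes of its factors, so
  the coefficient of degree \<open>CARD('n)\<close> is the determinant of the identity.\<close>

lemma coeff_det_shift:
  fixes A :: "'a::comm_ring_1^'n^'n"
  defines "B \<equiv> \<chi> i j. [:A $ i $ j, if i = j then 1 else 0:]"
  shows "poly.coeff (det B) CARD('n) = 1" "k > CARD('n) \<Longrightarrow> poly.coeff (det B) k = 0"
proof -
  have B: "poly.coeff (det B) k = (\<Sum>p | p permutes (UNIV :: 'n set).
      of_int (sign p) * poly.coeff (\<Prod>i\<in>UNIV. [:A $ i $ p i, if i = p i then 1 else 0:]) k)" for k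
    by (simp add: det_def B_def coeff_sum of_int_poly)
  have "poly.coeff (det B) CARD('n) = det (mat 1 :: 'a^'n^'n)"
    unfolding B by (subst coeff_prod_linear[THEN conjunct1]) (simp_all add: det_def mat_def)
  then show "poly.coeff (det B) CARD('n) = 1"
    by simp
  show "poly.coeff (det B) k = 0" if "k > CARD('n)"
    unfolding B using that coeff_prod_linear[OF finite, where a = "\<lambda>i. A $ i $ p i" and b = "\<lambda>i. if i = p i then 1 else 0"
        and I = UNIV for p]
    by (intro sum.neutral) auto
qed

section \<open>Real matrices with distinct real eigenvalues\<close>

lemma continuous_on_det:
  fixes A :: "real \<Rightarrow> real^'n^'n"
  assumes "\<And>i j. continuous_on S (\<lambda>t. A t $ i $ j)"
  shows "continuous_on S (\<lambda>t. det (A t))"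
  unfolding det_def by (intro continuous_intros assms)

lemma continuous_on_if_const: "continuous_on S (\<lambda>t. if b then t else a)"
  by (cases b) simp_all

text \<open>
  An open condition on \<open>Y\<close> that forces \<open>n\<close> distinct real eigenvalues.  The sample points interlace the
  roots \<open>0, -1, \<dots>, -(n-1)\<close> of \<open>det (Y + s I)\<close> for the diagonal matrix \<open>Y\<close> with entries \<open>0, \<dots>, n-1\<close>.
\<close>

definition alternating :: "real^'n^'n \<Rightarrow> bool"
  where "alternating Y \<longleftrightarrow> (\<forall>k\<le>CARD('n). (- 1) ^ k * det (Y + mat (1 / 2 - real k)) > 0)"

lemma exists_alternating: "\<exists>Y :: real^'n^'n. alternating Y"
proof -
  obtain e :: "'n \<Rightarrow> nat" where e: "bij_betw e UNIV {0..<CARD('n)}"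
    using ex_bij_betw_finite_nat[of "UNIV :: 'n set"] by auto
  define Y :: "real^'n^'n" where "Y = (\<chi> i j. if i = j then real (e i) else 0)"
  have "(- 1) ^ k * det (Y + mat (1 / 2 - real k)) > 0" if "k \<le> CARD('n)" for k
  proof -
    have "det (Y + mat (1 / 2 - real k)) = (\<Prod>i\<in>UNIV. real (e i) + (1 / 2 - real k))"
      by (subst det_diagonal) (simp_all add: Y_def mat_def)
    also have "\<dots> = (\<Prod>i<CARD('n). real i + (1 / 2 - real k))"
      using prod.reindex_bij_betw[OF e, of "\<lambda>i. real i + (1 / 2 - real k)"] by (simp add: atLeast0LessThan)
    finally have det: "det (Y + mat (1 / 2 - real k)) = (\<Prod>i<CARD('n). real i + (1 / 2 - real k))" .
    \<comment> \<open>The factor \<open>real i + (1 / 2 - real k)\<close> is negative exactly for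
      \<open>i < k\<close>, which gives \<open>k\<close> negative factors.\<close>
    have "(\<Prod>i<CARD('n). if i < k then - 1 else 1 :: real) = (- 1) ^ card ({..<CARD('n)} \<inter> {i. i < k})"
      by (simp add: prod.If_cases)
    also have "{..<CARD('n)} \<inter> {i. i < k} = {..<k}"
      using that by auto
    finally have "(- 1) ^ k * det (Y + mat (1 / 2 - real k)) =
        (\<Prod>i<CARD('n). (if i < k then - 1 else 1) * (real i + (1 / 2 - real k)))"
      by (simp add: det prod.distrib)
    also have "\<dots> > 0"
      by (rule prod_pos) auto
    finally show ?thesis .
  qed
  then show ?thesis
    unfolding alternating_def by blast
qed

lemma alternating_real_eigenvalues:
  fixes Y :: "real^'n^'n"
  assumes "alternating Y"
  obtains T where "finite T" "card T = CARD('n)" "\<And>t. t \<in> T \<Longrightarrow> det (Y + mat t) = 0"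
proof -
  let ?h = "\<lambda>t. det (Y + mat t)"
  have cont: "continuous_on S ?h" for S
    by (intro continuous_on_det) (auto simp: mat_def intro!: continuous_intros continuous_on_if_const)
  have "\<exists>t. - 1 / 2 - real k < t \<and> t < 1 / 2 - real k \<and> ?h t = 0" if "k < CARD('n)" for k
  proof -
    let ?f = "\<lambda>t. (- 1) ^ k * ?h t"
    have "?f (1 / 2 - real k) > 0"
      using assms that by (simp add: alternating_def)
    moreover have Suc_k: "1 / 2 - real (Suc k) = - 1 / 2 - real k"
      by simp
    have "- ?f (1 / 2 - real (Suc k)) > 0"
      using assms that unfolding alternating_def by (auto dest!: spec[of _ "Suc k"])
    then have "?f (- 1 / 2 - real k) < 0"
      unfolding Suc_k by simp
    moreover have "continuous_on {- 1 / 2 - real k..1 / 2 - real k} ?f"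
      by (intro continuous_intros cont)
    ultimately obtain t where t: "- 1 / 2 - real k \<le> t" "t \<le> 1 / 2 - real k" "?f t = 0"
      using IVT'[of ?f "- 1 / 2 - real k" 0 "1 / 2 - real k"] by auto
    \<comment> \<open>Excluding the endpoints puts the roots into disjoint open intervals, so that
      they are distinct.\<close>
    moreover have "t \<noteq> - 1 / 2 - real k" "t \<noteq> 1 / 2 - real k"
      using t(3) \<open>?f (1 / 2 - real k) > 0\<close> \<open>?f (- 1 / 2 - real k) < 0\<close> by auto
    ultimately show ?thesis
      by (intro exI[of _ t]) auto
  qed
  then obtain t where t: "\<And>k. k < CARD('n) \<Longrightarrow> - 1 / 2 - real k < t k \<and> t k < 1 / 2 - real k \<and> ?h (t k) = 0"
    by metis
  have "inj_on t {..<CARD('n)}"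
  proof (rule linorder_inj_onI)
    fix k l assume "k < l" "k \<in> {..<CARD('n)}" "l \<in> {..<CARD('n)}"
    moreover have "real k + 1 \<le> real l"
      using \<open>k < l\<close> by linarith
    ultimately show "t k \<noteq> t l"
      using t[of k] t[of l] by auto
  qed auto
  then show ?thesis
    using t by (intro that[of "t ` {..<CARD('n)}"]) (auto simp: card_image)
qed

text \<open>Finitely many strict inequalities between continuous functions of one entry define an
  open set, and a nonempty open set of reals is infinite. This supplies the line hypothesis of
  \<open>cpoly_eq_0_if_vanishes\<close>.\<close>

lemma alternating_perturb_infinite:
  fixes Y :: "real^'n^'n"
  assumes "alternating Y"
  shows "infinite {t. alternating (\<chi> i j. if (i, j) = v then t else Y $ i $ j)}"
proof -
  let ?Y = "\<lambda>t. \<chi> i j. if (i, j) = v then t else Y $ i $ j"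
  have eq: "{t. alternating (?Y t)} =
      (\<Inter>k\<in>{..CARD('n)}. {t. 0 < (- 1) ^ k * det (?Y t + mat (1 / 2 - real k))})"
    by (auto simp: alternating_def)
  have "continuous_on UNIV (\<lambda>t. (- 1) ^ k * det (?Y t + mat (1 / 2 - real k)))" for k
    by (intro continuous_intros continuous_on_det)
      (auto simp: mat_def intro!: continuous_intros continuous_on_if_const)
  then have "open {t. alternating (?Y t)}"
    unfolding eq by (intro open_INT ballI open_Collect_less continuous_on_const) auto
  moreover have "?Y (Y $ fst v $ snd v) = Y"
    by (auto simp: vec_eq_iff)
  then have "Y $ fst v $ snd v \<in> {t. alternating (?Y t)}"
    unfolding mem_Collect_eq using assms by (rule ssubst)
  then have "{t. alternating (?Y t)} \<noteq> {}"
    by (metis empty_iff)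
  ultimately show ?thesis
    using finite_imp_not_open by blast
qed

lemma det_poly_dvd_if_vanishes:
  fixes R :: "('n::finite \<times> 'n) cpoly"
  assumes R: "\<And>X :: real^'n^'n. det X = 0 \<Longrightarrow> evaluate (\<lambda>(i, j). complex_of_real (X $ i $ j)) R = 0"
  shows "det_poly dvd R"
proof -
  define c where "c = (\<lambda>(Y :: real^'n^'n) (i, j). complex_of_real (Y $ i $ j))"
  \<comment> \<open>Substitution of \<open>Y + s I\<close> for the generic matrix \<open>Y\<close>;
    the outer polynomial variable is \<open>s\<close>, and the coefficients are polynomials in the
    entries of \<open>Y\<close>.\<close>
  define \<Phi> where "\<Phi> = eval_with (\<lambda>a. [:const a:]) (\<lambda>(i, j). [:var (i, j) :: ('n \<times> 'n) cpoly, if i = j then 1 else 0:])"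
  have hom0: "is_ring_hom (\<lambda>a. [:const a :: ('n \<times> 'n) cpoly:])"
    by (rule is_ring_hom_comp[OF is_ring_hom_pCons is_ring_hom_const])
  have \<Phi>: "is_ring_hom \<Phi>"
    unfolding \<Phi>_def by (rule is_ring_hom_eval_with[OF hom0])
  have \<Phi>_0: "poly (\<Phi> P) 0 = P" for P
    by (rule ring_hom_eqI[where P = P, OF is_ring_hom_comp[OF is_ring_hom_poly \<Phi>]])
      (auto simp: \<Phi>_def hom0 is_ring_hom_def)
  have \<Phi>_det: "\<Phi> det_poly = det (\<chi> i j. [:(\<chi> i j. var (i, j)) $ i $ j, if i = j then 1 else 0:])"
    by (simp add: det_poly_def hom_det[OF \<Phi>]) (simp add: \<Phi>_def hom0)
  have "poly.coeff (\<Phi> det_poly) CARD('n) = 1" "\<And>i. i > CARD('n) \<Longrightarrow> poly.coeff (\<Phi> det_poly) i = 0"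
    unfolding \<Phi>_det by (rule coeff_det_shift, rule coeff_det_shift(2))
  then obtain q r where qr: "\<Phi> R = \<Phi> det_poly * q + r" "\<And>i. i \<ge> CARD('n) \<Longrightarrow> poly.coeff r i = 0"
    using monic_division by blast
  have vanish: "evaluate (c Y) (poly.coeff r i) = 0" if Y: "alternating Y" for Y i
  proof -
    define \<psi> where "\<psi> = map_poly (evaluate (c Y))"
    have \<psi>: "is_ring_hom \<psi>"
      unfolding \<psi>_def by (rule is_ring_hom_map_poly[OF is_ring_hom_evaluate])
    have eval: "poly (\<psi> (\<Phi> P)) (complex_of_real t) = evaluate (c (Y + mat t)) P" for t P
    proof (rule ring_hom_eqI[where P = P, OF is_ring_hom_comp[OF is_ring_hom_poly is_ring_hom_comp[OF \<psi> \<Phi>]] is_ring_hom_evaluate])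
      show "poly (\<psi> (\<Phi> (const a))) (complex_of_real t) = evaluate (c (Y + mat t)) (const a)" for a
        by (simp add: \<Phi>_def hom0 \<psi>_def map_poly_pCons hom_0[OF is_ring_hom_evaluate])
      show "poly (\<psi> (\<Phi> (var v))) (complex_of_real t) = evaluate (c (Y + mat t)) (var v)" for v
        by (cases v) (simp add: \<Phi>_def hom0 \<psi>_def map_poly_pCons hom_0[OF is_ring_hom_evaluate]
            hom_1[OF is_ring_hom_evaluate] c_def mat_def)
    qed
    obtain T where T: "finite T" "card T = CARD('n)" "\<And>t. t \<in> T \<Longrightarrow> det (Y + mat t) = 0"
      using alternating_real_eigenvalues[OF Y] by metis
    have det_c: "evaluate (c X) det_poly = complex_of_real (det X)" for X
      by (simp add: det_poly_def hom_det[OF is_ring_hom_evaluate] hom_det[OF is_ring_hom_complex_of_real] c_def)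
    \<comment> \<open>At a root \<open>t\<close> the matrix \<open>Y + t I\<close> is real and
      singular, so \<open>R\<close> and the determinant vanish there, and hence the remainder
      does.\<close>
    have "poly (\<psi> r) (complex_of_real t) = 0" if "t \<in> T" for t
    proof -
      have "poly (\<psi> (\<Phi> R)) (complex_of_real t) = 0"
        using R[OF T(3)[OF that]] by (simp add: eval c_def)
      moreover have "poly (\<psi> (\<Phi> det_poly)) (complex_of_real t) = 0"
        using T(3)[OF that] by (simp add: eval det_c)
      ultimately show ?thesis
        by (simp add: qr(1) hom_add[OF \<psi>] hom_mult[OF \<psi>])
    qed
    then have roots: "complex_of_real ` T \<subseteq> {s. poly (\<psi> r) s = 0}"
      by auto
    have "\<psi> r = 0"
    proof (rule ccontr)
      assume nz: "\<psi> r \<noteq> 0"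
      have "CARD('n) = card (complex_of_real ` T)"
        by (simp add: card_image inj_on_def T(2))
      also have "\<dots> \<le> degree (\<psi> r)"
        using card_mono[OF poly_roots_finite[OF nz] roots] card_poly_roots_bound[OF nz] by linarith
      \<comment> \<open>As many roots as \<open>CARD('n)\<close> force at least that degree, where
        the remainder has no coefficients.\<close>
      finally have "poly.coeff (\<psi> r) (degree (\<psi> r)) = 0"
        using qr(2) by (simp add: \<psi>_def coeff_map_poly hom_0[OF is_ring_hom_evaluate])
      then show False
        using nz by simp
    qed
    then show ?thesis
      by (metis \<psi>_def coeff_0 coeff_map_poly hom_0 is_ring_hom_evaluate)
  qed
  have "poly.coeff r i = 0" for i
  proof (rule cpoly_eq_0_if_vanishes[where U = "c ` {Y. alternating Y}"])
    show "c ` {Y. alternating Y} \<noteq> {}"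
      using exists_alternating by auto
    show "infinite {t. y(v := t) \<in> c ` {Y. alternating Y}}" if "y \<in> c ` {Y. alternating Y}" for y v
    proof -
      obtain Y where Y: "alternating Y" "y = c Y"
        using \<open>y \<in> _\<close> by auto
      let ?Y = "\<lambda>t. \<chi> i j. if (i, j) = v then t else Y $ i $ j"
      have "y(v := complex_of_real t) = c (?Y t)" for t
        by (auto simp: Y(2) c_def fun_eq_iff)
      then have "complex_of_real ` {t. alternating (?Y t)} \<subseteq> {t. y(v := t) \<in> c ` {Y. alternating Y}}"
        by auto
      moreover have "infinite (complex_of_real ` {t. alternating (?Y t)})"
        using alternating_perturb_infinite[OF Y(1), of v] by (simp add: finite_image_iff inj_on_def)
      ultimately show ?thesis
        by (rule infinite_super)
    qed
  qed (auto simp: vanish)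
  then have "\<Phi> R = \<Phi> det_poly * q"
    using qr(1) by (simp add: poly_eq_iff)
  \<comment> \<open>Set \<open>s = 0\<close>.\<close>
  then have "R = det_poly * poly q 0"
    using \<Phi>_0[of R] \<Phi>_0[of det_poly] by simp
  then show ?thesis
    by simp
qed

corollary det_poly_dvd_trace_exterior_power_hessian:
  assumes "odd j"
  shows "(det_poly :: ('n::finite \<times> 'n) cpoly) dvd trace (exterior_power j (hessian det_poly))"
  using assms by (intro det_poly_dvd_if_vanishes evaluate_trace_exterior_power_hessian_det_singular)

section \<open>Polynomials in the coefficients of a form\<close>

text \<open>Renaming the finitely many variables into \<open>nat\<close> makes the monomials
  linearly ordered, where leading terms multiply. The renaming has a left inverse, so nothing is
  lost.\<close>

lemma cpoly_no_zero_divisors: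
  fixes P P' :: "'v::finite cpoly"
  assumes "P * P' = 0"
  shows "P = 0 \<or> P' = 0"
proof -
  obtain e :: "'v \<Rightarrow> nat" where e: "inj e"
    using finite_imp_inj_to_nat_seg[of "UNIV :: 'v set"] by auto
  define f where "f = substitute (\<lambda>v. var (e v))"
  have f: "is_ring_hom f"
    unfolding f_def by (rule is_ring_hom_substitute)
  have inv: "substitute (\<lambda>k. var (inv e k)) (f P) = P" for P
    using e by (simp add: f_def substitute_substitute substitute_vars)
  have "f P * f P' = 0"
    using assms by (metis f hom_mult hom_0)
  then have "f P = 0 \<or> f P' = 0"
    by simp
  then show ?thesis
    by (metis inv hom_0 is_ring_hom_substitute)
qed

definition vars_in :: "'v set \<Rightarrow> 'v cpoly set"
  where "vars_in A = {P. \<forall>m\<in>Poly_Mapping.keys P. Poly_Mapping.keys m \<subseteq> A}"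

lemma vars_in_add: "P \<in> vars_in A \<Longrightarrow> P' \<in> vars_in A \<Longrightarrow> P + P' \<in> vars_in A"
  using Poly_Mapping.keys_add[of P P'] by (auto simp: vars_in_def)

lemma vars_in_const: "const c \<in> vars_in A"
  by (simp add: vars_in_def const_def)

lemma vars_in_var: "v \<in> A \<Longrightarrow> var v \<in> vars_in A"
  by (simp add: vars_in_def var_def monom_def)

lemma vars_in_mult:
  assumes "P \<in> vars_in A" "P' \<in> vars_in A"
  shows "P * P' \<in> vars_in A"
proof -
  have "Poly_Mapping.keys m \<subseteq> A" if m: "m \<in> Poly_Mapping.keys (P * P')" for m
  proof -
    obtain k k' where k: "k \<in> Poly_Mapping.keys P" "k' \<in> Poly_Mapping.keys P'" "m = k + k'"
      using m Poly_Mapping.keys_mult[of P P'] by blast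
    then have "Poly_Mapping.keys m \<subseteq> Poly_Mapping.keys k \<union> Poly_Mapping.keys k'"
      using Poly_Mapping.keys_add by metis
    also have "\<dots> \<subseteq> A"
      using assms k by (auto simp: vars_in_def)
    finally show ?thesis .
  qed
  then show ?thesis
    by (simp add: vars_in_def)
qed

lemma vars_in_sum: "(\<And>s. s \<in> S \<Longrightarrow> f s \<in> vars_in A) \<Longrightarrow> sum f S \<in> vars_in A"
  using vars_in_const[of 0 A]
  by (induction S rule: infinite_finite_induct) (auto intro: vars_in_add simp: hom_0[OF is_ring_hom_const])

lemma vars_in_substitute: "(\<And>v. x v \<in> vars_in A) \<Longrightarrow> substitute x P \<in> vars_in A"
  by (induction P rule: cpoly_induct)
    (simp_all add: vars_in_const hom_add[OF is_ring_hom_substitute] hom_mult[OF is_ring_hom_substitute]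
      vars_in_add vars_in_mult)

lemma forms_on_eq: "forms_on n d = homog d \<inter> vars_in {m. mdeg m = n}"
  by (auto simp: forms_on_def vars_in_def)

lemma forms_on_0: "0 \<in> forms_on n d"
  by (simp add: forms_on_def)

lemma forms_on_add: "F \<in> forms_on n d \<Longrightarrow> F' \<in> forms_on n d \<Longrightarrow> F + F' \<in> forms_on n d"
  by (simp add: forms_on_eq homog_add vars_in_add)

lemma forms_on_mult: "F \<in> forms_on n d \<Longrightarrow> F' \<in> forms_on n d' \<Longrightarrow> F * F' \<in> forms_on n (d + d')"
  by (simp add: forms_on_eq homog_mult vars_in_mult)

lemma forms_on_const: "const c \<in> forms_on n 0"
  by (simp add: forms_on_eq homog_const vars_in_const)

lemma forms_on_scale: "F \<in> forms_on n d \<Longrightarrow> scale c F \<in> forms_on n d"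
  unfolding scale_def by (metis add_0 forms_on_const forms_on_mult)

lemma forms_on_power: "F \<in> forms_on n 1 \<Longrightarrow> F ^ d \<in> forms_on n d"
proof (induction d)
  case 0
  show ?case
    using forms_on_const[of 1 n] by (simp add: hom_1[OF is_ring_hom_const])
next
  case (Suc d)
  then show ?case
    using forms_on_mult[of F n 1 "F ^ d" d] by simp
qed

lemma forms_on_var: "mdeg m = n \<Longrightarrow> var m \<in> forms_on n 1"
  by (simp add: forms_on_eq homog_var vars_in_var del: One_nat_def)

lemma is_ring_hom_eval_at: "is_ring_hom (\<lambda>F. eval_at F P)"
  using is_ring_hom_evaluate by (simp add: eval_at_def)

lemma eval_at_scale_form:
  assumes "F \<in> forms_on n d"
  shows "eval_at F (scale c P) = c ^ d * eval_at F P"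
proof -
  have "(\<Prod>v\<in>Poly_Mapping.keys M. (c * x v) ^ Poly_Mapping.lookup M v) =
      c ^ d * (\<Prod>v\<in>Poly_Mapping.keys M. x v ^ Poly_Mapping.lookup M v)"
    if "M \<in> Poly_Mapping.keys F" for M and x :: "'a monomial \<Rightarrow> complex"
    using assms that by (simp add: power_mult_distrib prod.distrib forms_on_def homog_def mdeg_def flip: power_sum)
  then show ?thesis
    by (simp add: eval_at_def evaluate_def eval_with_def lookup_scale sum_distrib_left mult_ac)
qed

text \<open>Speaking of functions lets polynomiality be proved by closure rules, without writing
  \<open>F\<close> down. Degrees are tracked because closed sets are cut out by homogeneous
  \<open>F\<close>.\<close>

definition poly_on_forms :: "nat \<Rightarrow> nat \<Rightarrow> ('v cpoly \<Rightarrow> complex) \<Rightarrow> bool"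
  where "poly_on_forms n d f \<longleftrightarrow> (\<exists>F\<in>forms_on n d. \<forall>P\<in>homog n. f P = eval_at F P)"

lemma poly_on_forms_const: "poly_on_forms n 0 (\<lambda>_. c)"
  unfolding poly_on_forms_def eval_at_def
  by (intro bexI[of _ "const c"]) (simp_all add: forms_on_const)

lemma poly_on_forms_lookup: "poly_on_forms n 1 (\<lambda>P. Poly_Mapping.lookup P m)"
proof (cases "mdeg m = n")
  case True
  then show ?thesis
    unfolding poly_on_forms_def eval_at_def
    by (intro bexI[of _ "var m"]) (simp_all add: forms_on_var del: One_nat_def)
next
  case False
  then have "\<forall>P\<in>homog n. Poly_Mapping.lookup P m = 0"
    by (auto dest: homogD)
  then show ?thesis
    unfolding poly_on_forms_def
    by (intro bexI[of _ 0]) (simp_all add: forms_on_0 hom_0[OF is_ring_hom_eval_at])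
qed

lemma poly_on_forms_add:
  "poly_on_forms n d f \<Longrightarrow> poly_on_forms n d g \<Longrightarrow> poly_on_forms n d (\<lambda>P. f P + g P)"
  unfolding poly_on_forms_def by (metis forms_on_add hom_add[OF is_ring_hom_eval_at])

lemma poly_on_forms_mult:
  "poly_on_forms n d f \<Longrightarrow> poly_on_forms n e g \<Longrightarrow> poly_on_forms n (d + e) (\<lambda>P. f P * g P)"
  unfolding poly_on_forms_def by (metis forms_on_mult hom_mult[OF is_ring_hom_eval_at])

lemma poly_on_forms_cmult: "poly_on_forms n d f \<Longrightarrow> poly_on_forms n d (\<lambda>P. c * f P)"
  using poly_on_forms_mult[of n 0 "\<lambda>_. c" d f] by (simp add: poly_on_forms_const)

lemma poly_on_forms_diff:
  "poly_on_forms n d f \<Longrightarrow> poly_on_forms n d g \<Longrightarrow> poly_on_forms n d (\<lambda>P. f P - g P)"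
  using poly_on_forms_add[of n d f "\<lambda>P. - 1 * g P"] poly_on_forms_cmult[of n d g "- 1"] by simp

lemma poly_on_forms_0: "poly_on_forms n d (\<lambda>_. 0)"
  using forms_on_0 by (auto simp: poly_on_forms_def hom_0[OF is_ring_hom_eval_at] intro!: bexI[of _ 0])

lemma poly_on_forms_sum:
  "(\<And>s. s \<in> S \<Longrightarrow> poly_on_forms n d (f s)) \<Longrightarrow> poly_on_forms n d (\<lambda>P. \<Sum>s\<in>S. f s P)"
  by (induction S rule: infinite_finite_induct) (simp_all add: poly_on_forms_0 poly_on_forms_add)

definition poly_map_on_forms :: "nat \<Rightarrow> nat \<Rightarrow> ('v cpoly \<Rightarrow> 'w cpoly) \<Rightarrow> bool"
  where "poly_map_on_forms n d f \<longleftrightarrow> (\<forall>m. poly_on_forms n d (\<lambda>P. Poly_Mapping.lookup (f P) m))"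

lemma poly_map_on_forms_id: "poly_map_on_forms n 1 (\<lambda>P. P)"
  unfolding poly_map_on_forms_def by (intro allI poly_on_forms_lookup)

lemma poly_map_on_forms_constant: "poly_map_on_forms n 0 (\<lambda>_. P)"
  unfolding poly_map_on_forms_def by (intro allI poly_on_forms_const)

lemma poly_map_on_forms_sum:
  "(\<And>s. s \<in> S \<Longrightarrow> poly_map_on_forms n d (f s)) \<Longrightarrow> poly_map_on_forms n d (\<lambda>P. \<Sum>s\<in>S. f s P)"
  by (simp add: poly_map_on_forms_def lookup_sum poly_on_forms_sum)

lemma poly_map_on_forms_partial:
  "poly_map_on_forms n d f \<Longrightarrow> poly_map_on_forms n d (\<lambda>P. partial v (f P))"
  by (simp add: poly_map_on_forms_def lookup_partial poly_on_forms_cmult)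

text \<open>The index set depends on \<open>m\<close> alone and not on the supports of the factors,
  so each coefficient of a product is a fixed bilinear expression in the coefficients.\<close>

lemma lookup_mult_sum:
  fixes f g :: "'v::finite cpoly"
  shows "Poly_Mapping.lookup (f * g) m =
    (\<Sum>(a, b) | a + b = m. Poly_Mapping.lookup f a * Poly_Mapping.lookup g b)"
proof -
  have "{(a, b). a + b = m} \<subseteq> {a. mdeg a \<le> mdeg m} \<times> {b. mdeg b \<le> mdeg m}"
    by (auto simp: mdeg_add)
  then have fin: "finite {(a, b). a + b = m}"
    by (rule finite_subset) (intro finite_cartesian_product finite_mdeg_le)
  have "Poly_Mapping.lookup (f * g) m =
      (\<Sum>(a, b). Poly_Mapping.lookup f a * Poly_Mapping.lookup g b when m = a + b)"
    by (simp add: times_poly_mapping.rep_eq prod_fun_unfold_prod)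
  also have "\<dots> = (\<Sum>(a, b) | a + b = m. Poly_Mapping.lookup f a * Poly_Mapping.lookup g b when m = a + b)"
    by (rule Sum_any.expand_superset[OF fin]) (auto simp: when_def split: if_splits)
  also have "\<dots> = (\<Sum>(a, b) | a + b = m. Poly_Mapping.lookup f a * Poly_Mapping.lookup g b)"
    by (intro sum.cong) (auto simp: when_def)
  finally show ?thesis .
qed

lemma poly_map_on_forms_mult:
  fixes f g :: "'v cpoly \<Rightarrow> 'w::finite cpoly"
  assumes "poly_map_on_forms n d f" "poly_map_on_forms n e g"
  shows "poly_map_on_forms n (d + e) (\<lambda>P. f P * g P)"
  unfolding poly_map_on_forms_def lookup_mult_sum case_prod_unfold
  using assms by (intro allI poly_on_forms_sum poly_on_forms_mult) (simp_all add: poly_map_on_forms_def)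

lemma poly_map_on_forms_prod:
  fixes f :: "'i \<Rightarrow> 'v cpoly \<Rightarrow> 'w::finite cpoly"
  assumes "finite S" "\<And>s. s \<in> S \<Longrightarrow> poly_map_on_forms n d (f s)"
  shows "poly_map_on_forms n (card S * d) (\<lambda>P. \<Prod>s\<in>S. f s P)"
  using assms
proof (induction S rule: finite_induct)
  case (insert s S)
  then show ?case
    using poly_map_on_forms_mult[of n d "f s" "card S * d" "\<lambda>P. \<Prod>s\<in>S. f s P"] by simp
qed (simp add: poly_map_on_forms_constant)

lemma poly_map_on_forms_hessian:
  "poly_map_on_forms n 1 (\<lambda>P. hessian P $ p $ q)"
  by (simp only: hessian_def vec_lambda_beta) (intro poly_map_on_forms_partial poly_map_on_forms_id)

text \<open>Second derivatives are linear in the coefficients of \<open>P\<close>, and every term of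
  a principal minor multiplies \<open>j\<close> of them.\<close>

lemma poly_map_on_forms_trace_exterior_power_hessian:
  "poly_map_on_forms n j (\<lambda>P :: 'v::finite cpoly. trace (exterior_power j (hessian P)))"
proof -
  have "poly_map_on_forms n j (\<lambda>P :: 'v cpoly. of_int (sign \<pi>) * (\<Prod>i\<in>I. hessian P $ \<pi> i $ i))"
    if "card I = j" for \<pi> and I :: "'v set"
    using poly_map_on_forms_mult[OF poly_map_on_forms_constant
        poly_map_on_forms_prod[OF finite[of I] poly_map_on_forms_hessian], of n] that by simp
  then show ?thesis
    unfolding trace_exterior_power principal_minor_def by (intro poly_map_on_forms_sum) auto
qed

section \<open>Linear dependence as a closed condition\<close>

text \<open>
  Fraction-free Gaussian elimination: subtracting multiples of one vector clears a coordinate of all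
  the others, and the coordinate, being nonzero at \<open>P\<^sub>0\<close>, need not be inverted.
\<close>

lemma form_separating_independent:
  fixes v :: "'i \<Rightarrow> 'v cpoly \<Rightarrow> 'w cpoly"
  assumes "finite I" "\<And>i. i \<in> I \<Longrightarrow> \<exists>d. poly_map_on_forms n d (v i)" "poly_map_on_forms n e r"
    and P0: "P0 \<in> homog n"
    and "\<And>c s. const c * r P0 + (\<Sum>i\<in>I. const (s i) * v i P0) = 0 \<Longrightarrow> c = 0 \<and> (\<forall>i\<in>I. s i = 0)"
  shows "\<exists>d. \<exists>F\<in>forms_on n d. eval_at F P0 \<noteq> 0 \<and>
    (\<forall>P\<in>homog n. (\<exists>s. r P = (\<Sum>i\<in>I. const (s i) * v i P)) \<longrightarrow> eval_at F P = 0)"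
  using assms(1,2,3,5)
proof (induction I arbitrary: v r e rule: finite_induct)
  case empty
  \<comment> \<open>With no vectors left, any coefficient of \<open>r\<close> that is nonzero at
    \<open>P0\<close> is the form sought.\<close>
  have "r P0 \<noteq> 0"
    using empty(3)[of 1] by auto
  then obtain m where m: "Poly_Mapping.lookup (r P0) m \<noteq> 0"
    by (metis poly_mapping_eqI lookup_zero)
  obtain F where F: "F \<in> forms_on n e" "\<And>P. P \<in> homog n \<Longrightarrow> Poly_Mapping.lookup (r P) m = eval_at F P"
    using empty(2) unfolding poly_map_on_forms_def poly_on_forms_def by blast
  have "eval_at F P = 0" if "P \<in> homog n" "r P = 0" for P
    using F(2)[OF that(1)] that(2) by simp
  then show ?case
    using F(1) F(2)[OF P0] m by (intro exI[of _ e] bexI[of _ F]) simp_all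
next
  case (insert k I)
  note [simp] = hom_add[OF is_ring_hom_const] hom_mult[OF is_ring_hom_const] hom_sum[OF is_ring_hom_const]
    hom_uminus[OF is_ring_hom_const] hom_diff[OF is_ring_hom_const] hom_0[OF is_ring_hom_const] hom_1[OF is_ring_hom_const]
  have split: "(\<Sum>i\<in>insert k I. const (s i) * v i P) =
      const (s k) * v k P + (\<Sum>i\<in>I. const (s i) * v i P)" for s P
    using insert.hyps by simp
  have "v k P0 \<noteq> 0"
  proof
    assume "v k P0 = 0"
    moreover have "(\<Sum>i\<in>I. const (if i = k then 1 else 0) * v i P0) = 0"
      using insert.hyps by (intro sum.neutral) auto
    ultimately show False
      using insert.prems(3)[of 0 "\<lambda>i. if i = k then 1 else 0"] unfolding split by simp
  qed
  then obtain m where m: "Poly_Mapping.lookup (v k P0) m \<noteq> 0"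
    by (metis poly_mapping_eqI lookup_zero)
  \<comment> \<open>\<open>m\<close> is the pivot coordinate. Cross multiplication clears it and
    sends \<open>v k\<close> itself to zero.\<close>
  define elim where "elim = (\<lambda>u P.
    const (Poly_Mapping.lookup (v k P) m) * u P - const (Poly_Mapping.lookup (u P) m) * v k P)"
  obtain dk where dk: "poly_map_on_forms n dk (v k)"
    using insert.prems(1) by blast
  have elim_poly: "poly_map_on_forms n (dk + d) (elim u)" if "poly_map_on_forms n d u" for d u
  proof -
    have u: "poly_on_forms n d (\<lambda>P. Poly_Mapping.lookup (u P) m')"
      and k: "poly_on_forms n dk (\<lambda>P. Poly_Mapping.lookup (v k P) m')" for m'
      using that dk by (simp_all add: poly_map_on_forms_def)
    show ?thesis
      unfolding poly_map_on_forms_def elim_def lookup_minus lookup_const_mult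
      using poly_on_forms_mult[OF k u] poly_on_forms_mult[OF u k]
      by (intro allI poly_on_forms_diff) (simp_all add: add.commute[of d])
  qed
  have "\<exists>d. \<exists>F\<in>forms_on n d. eval_at F P0 \<noteq> 0 \<and>
      (\<forall>P\<in>homog n. (\<exists>s. elim r P = (\<Sum>i\<in>I. const (s i) * elim (v i) P)) \<longrightarrow> eval_at F P = 0)"
  proof (rule insert.IH)
    show "\<exists>d. poly_map_on_forms n d (elim (v i))" if "i \<in> I" for i
      using insert.prems(1)[of i] that elim_poly by blast
    show "poly_map_on_forms n (dk + e) (elim r)"
      using insert.prems(2) by (rule elim_poly)
    show "c = 0 \<and> (\<forall>i\<in>I. s i = 0)"
      if "const c * elim r P0 + (\<Sum>i\<in>I. const (s i) * elim (v i) P0) = 0" for c s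
    proof -
      define a where "a = Poly_Mapping.lookup (v k P0) m"
      \<comment> \<open>The total multiple of \<open>v k\<close> subtracted by \<open>elim\<close>:
        with it, a relation among the eliminated vectors at \<open>P0\<close> becomes one among the
        original vectors, the others scaled by the pivot \<open>a\<close>.\<close>
      define b where "b = - (c * Poly_Mapping.lookup (r P0) m + (\<Sum>i\<in>I. s i * Poly_Mapping.lookup (v i P0) m))"
      define s' where "s' = (\<lambda>i. if i = k then b else s i * a)"
      have "(\<Sum>i\<in>I. const (s' i) * v i P0) = (\<Sum>i\<in>I. const (s i * a) * v i P0)"
        using insert.hyps by (intro sum.cong) (auto simp: s'_def)
      then have "const (c * a) * r P0 + (\<Sum>i\<in>insert k I. const (s' i) * v i P0) =
          const c * elim r P0 + (\<Sum>i\<in>I. const (s i) * elim (v i) P0)"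
        unfolding split
        by (simp add: s'_def b_def a_def elim_def right_diff_distrib sum_subtractf algebra_simps
            sum_distrib_left sum_distrib_right)
      then have "c * a = 0 \<and> (\<forall>i\<in>insert k I. s' i = 0)"
        using that by (intro insert.prems(3)) simp
      then show ?thesis
        using m insert.hyps by (auto simp: a_def s'_def split: if_splits)
    qed
  qed
  then obtain d F where F: "F \<in> forms_on n d" "eval_at F P0 \<noteq> 0"
    "\<And>P s. P \<in> homog n \<Longrightarrow> elim r P = (\<Sum>i\<in>I. const (s i) * elim (v i) P) \<Longrightarrow> eval_at F P = 0"
    by blast
  have "eval_at F P = 0" if P: "P \<in> homog n" "r P = (\<Sum>i\<in>insert k I. const (s i) * v i P)" for P s
  proof -
    have "Poly_Mapping.lookup (r P) m = s k * Poly_Mapping.lookup (v k P) m +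
        (\<Sum>i\<in>I. s i * Poly_Mapping.lookup (v i P) m)"
      unfolding P(2) split by (simp add: lookup_add lookup_const_mult lookup_sum)
    \<comment> \<open>Since \<open>elim\<close> is linear in its argument and kills
      \<open>v k\<close>, the relation persists. No division occurs, so this holds even where the
      pivot vanishes.\<close>
    then have "elim r P = (\<Sum>i\<in>I. const (s i) * elim (v i) P)"
      unfolding elim_def P(2) split
      by (simp add: right_diff_distrib sum_subtractf algebra_simps sum_distrib_left sum_distrib_right)
    then show ?thesis
      using F(3) P(1) by blast
  qed
  then show ?case
    using F(1,2) by blast
qed

section \<open>The orbit closure of the determinant\<close>

lemma det_poly_neq_0: "(det_poly :: ('n::finite \<times> 'n) cpoly) \<noteq> 0"
proof
  assume "(det_poly :: ('n \<times> 'n) cpoly) = 0"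
  then have "evaluate (entry (mat 1)) (det_poly :: ('n \<times> 'n) cpoly) = 0"
    by (simp add: hom_0[OF is_ring_hom_evaluate])
  moreover have "evaluate (entry (mat 1)) (det_poly :: ('n \<times> 'n) cpoly) = det (mat 1 :: complex^'n^'n)"
    by (simp add: det_poly_def hom_det[OF is_ring_hom_evaluate] entry_def)
  ultimately show False
    by simp
qed

lemma act_det_poly_neq_0: "g \<in> orth_group \<Longrightarrow> act g det_poly \<noteq> 0"
  using act_inv_act[of g det_poly] det_poly_neq_0
  by (metis hom_0 is_ring_hom_act)

text \<open>The zero set of the single form \<open>F\<close> is closed and contains the orbit, hence
  also the hull.\<close>

lemma vanishes_on_det_orbit_closure:
  fixes P :: "('n::finite \<times> 'n) cpoly"
  assumes F: "F \<in> forms_on CARD('n) d" "\<And>g. g \<in> orth_group \<Longrightarrow> eval_at F (act g det_poly) = 0"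
    and P: "proj_point P \<in> det_orbit_closure"
  shows "eval_at F P = 0"
proof -
  define Z where "Z = {proj_point P | P. P \<in> homog CARD('n) \<and> P \<noteq> 0 \<and> (\<forall>F'\<in>{F}. eval_at F' P = 0)}"
  have "zariski_closed CARD('n) Z"
    unfolding zariski_closed_def Z_def using F(1) by (intro exI[of _ "{F}"]) auto
  moreover have "proj_point (act g det_poly) \<in> Z" if "g \<in> orth_group" for g
    using F(2)[OF that] homog_act[OF homog_det_poly] act_det_poly_neq_0[OF that]
    unfolding Z_def by blast
  then have "(\<lambda>g. proj_point (act g det_poly)) ` orth_group \<subseteq> Z"
    by blast
  ultimately have "det_orbit_closure \<subseteq> Z"
    unfolding det_orbit_closure_def by (intro hull_minimal)
  then have "proj_point P \<in> Z"
    using P by blast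
  then obtain P' where P': "proj_point P = proj_point P'" "eval_at F P' = 0"
    by (auto simp: Z_def)
  have "scale 1 P = P"
    by (simp add: scale_def hom_1[OF is_ring_hom_const])
  then have "P \<in> proj_point P"
    unfolding proj_point_def by (metis (mono_tags, lifting) mem_Collect_eq zero_neq_one)
  \<comment> \<open>Membership in the zero set is witnessed by some representative
    \<open>P'\<close>; homogeneity of \<open>F\<close> transfers the vanishing to
    \<open>P\<close>.\<close>
  then obtain c where "P = scale c P'"
    unfolding P'(1) by (auto simp: proj_point_def)
  then show ?thesis
    using P'(2) eval_at_scale_form[OF F(1)] by simp
qed

lemma dvd_trace_exterior_power_hessian:
  fixes P :: "('n::finite \<times> 'n) cpoly"
  assumes "odd j" and P: "P \<in> homog CARD('n)" "P \<noteq> 0" "proj_point P \<in> det_orbit_closure"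
  shows "P dvd trace (exterior_power j (hessian P))"
proof (rule ccontr)
  define r where "r = (\<lambda>P :: ('n \<times> 'n) cpoly. trace (exterior_power j (hessian P)))"
  assume "\<not> P dvd trace (exterior_power j (hessian P))"
  then have ndvd: "\<not> P dvd r P"
    by (simp add: r_def)
  obtain S where S: "r det_poly = det_poly * S"
    using det_poly_dvd_trace_exterior_power_hessian[OF \<open>odd j\<close>, where 'n = 'n] by (auto simp: r_def elim: dvdE)
  \<comment> \<open>A crude bound on the degrees in the quotient \<open>S\<close>, which
    \<open>act g S\<close> also obeys; hence \<open>A\<close> does not depend on
    \<open>g\<close>.\<close>
  define K where "K = (\<Sum>m\<in>Poly_Mapping.keys S. mdeg m)"
  define A :: "('n \<times> 'n) monomial set" where "A = {m. mdeg m \<le> K}"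
  have "finite A"
    unfolding A_def by (rule finite_mdeg_le)
  have "\<exists>d. \<exists>F\<in>forms_on CARD('n) d. eval_at F P \<noteq> 0 \<and> (\<forall>P\<in>homog CARD('n).
      (\<exists>s. r P = (\<Sum>m\<in>A. const (s m) * (monom m * P))) \<longrightarrow> eval_at F P = 0)"
  proof (rule form_separating_independent[OF \<open>finite A\<close> _ _ P(1)])
    show "\<exists>d. poly_map_on_forms CARD('n) d (\<lambda>P. monom m * P)" for m :: "('n \<times> 'n) monomial"
      using poly_map_on_forms_mult[OF poly_map_on_forms_constant poly_map_on_forms_id] by blast
    show "poly_map_on_forms CARD('n) j r"
      unfolding r_def by (rule poly_map_on_forms_trace_exterior_power_hessian)
    show "c = 0 \<and> (\<forall>m\<in>A. s m = 0)" if eq: "const c * r P + (\<Sum>m\<in>A. const (s m) * (monom m * P)) = 0" for c s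
    proof -
      define T where "T = (\<Sum>m\<in>A. const (s m) * monom m)"
      have eq: "const c * r P = - (P * T)"
        using eq by (simp add: T_def sum_distrib_left mult_ac add_eq_0_iff)
      \<comment> \<open>Otherwise dividing by \<open>c\<close> would exhibit \<open>r P\<close> as a
        multiple of \<open>P\<close>.\<close>
      have "c = 0"
      proof (rule ccontr)
        assume "c \<noteq> 0"
        then have "r P = const (inverse c) * (const c * r P)"
          by (simp add: hom_1[OF is_ring_hom_const] flip: mult.assoc hom_mult[OF is_ring_hom_const])
        also have "\<dots> = P * (const (inverse c) * - T)"
          unfolding eq by (simp add: mult_ac)
        finally show False
          using ndvd by (metis dvd_triv_left)
      qed
      then have "P * T = 0"
        using eq by (simp add: hom_0[OF is_ring_hom_const])
      then have "T = 0"
        using cpoly_no_zero_divisors P(2) by blast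
      moreover have "Poly_Mapping.lookup T m = s m" if "m \<in> A" for m
        using \<open>finite A\<close> that
        by (simp add: T_def lookup_sum lookup_const_mult lookup_monom if_distrib[where f = "\<lambda>x. _ * x"] cong: if_cong)
      ultimately show ?thesis
        using \<open>c = 0\<close> by auto
    qed
  qed
  then obtain d F where F: "F \<in> forms_on CARD('n) d" "eval_at F P \<noteq> 0"
    and van: "\<And>P s. P \<in> homog CARD('n) \<Longrightarrow> r P = (\<Sum>m\<in>A. const (s m) * (monom m * P)) \<Longrightarrow> eval_at F P = 0"
    by blast
  have "eval_at F (act g det_poly) = 0" if g: "g \<in> orth_group" for g
  proof (rule van)
    show "act g det_poly \<in> homog CARD('n)"
      by (intro homog_act homog_det_poly)
    have "mdeg m \<in> {..K}" if "m \<in> Poly_Mapping.keys (act g S)" for m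
    proof (rule mdeg_substitute)
      show "m \<in> Poly_Mapping.keys (substitute (\<lambda>p. linear_form (g (matrix_unit p))) S)"
        using that by (simp add: act_def)
      show "mdeg k \<in> {..K}" if "k \<in> Poly_Mapping.keys S" for k
        unfolding K_def using that by (auto intro: member_le_sum)
    qed (rule homog_linear_form)
    then have "act g S = (\<Sum>m\<in>A. const (Poly_Mapping.lookup (act g S) m) * monom m)"
      using \<open>finite A\<close> by (intro cpoly_eq_sum) (auto simp: A_def)
    moreover have "r (act g det_poly) = act g S * act g det_poly"
      using S by (simp add: r_def trace_exterior_power_hessian_act[OF g] hom_mult[OF is_ring_hom_act] mult.commute)
    ultimately show "r (act g det_poly) =
        (\<Sum>m\<in>A. const (Poly_Mapping.lookup (act g S) m) * (monom m * act g det_poly))"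
      by (metis (no_types, lifting) sum.cong sum_distrib_right mult.assoc)
  qed
  then show False
    using vanishes_on_det_orbit_closure[OF F(1) _ P(3)] F(2) by blast
qed

section \<open>The module of forms vanishing on the orbit\<close>

text \<open>The degree \<open>d\<close> part of the vanishing ideal of the orbit.\<close>

definition orbit_ideal :: "nat \<Rightarrow> ('n::finite \<times> 'n) monomial cpoly set"
  where "orbit_ideal d =
    {F \<in> forms_on CARD('n) d. \<forall>g\<in>orth_group. eval_at F (act g det_poly) = 0}"

lemma act_forms_in_forms_on:
  fixes F :: "('n::finite \<times> 'n) monomial cpoly"
  assumes "F \<in> forms_on n d"
  shows "act_forms n g F \<in> forms_on n d"
proof -
  let ?x = "\<lambda>m. \<Sum>m' | mdeg m' = n. scale (Poly_Mapping.lookup (act (inv g) (monom m')) m) (var m')"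
  have "?x m \<in> homog 1" for m
    by (intro homog_sum homog_scale homog_var)
  moreover have "?x m \<in> vars_in {m. mdeg m = n}" for m
    unfolding scale_def by (intro vars_in_sum vars_in_mult vars_in_const vars_in_var)
  ultimately show ?thesis
    using assms by (simp add: forms_on_eq act_forms_def homog_substitute vars_in_substitute)
qed

lemma eval_at_act_forms:
  fixes F :: "('n::finite \<times> 'n) monomial cpoly"
  assumes "P \<in> homog n"
  shows "eval_at (act_forms n g F) P = eval_at F (act (inv g) P)"
proof -
  have "finite {m :: ('n \<times> 'n) monomial. mdeg m = n}"
    by (rule finite_subset[OF _ finite_mdeg_le[of n]]) auto
  then have "P = (\<Sum>m | mdeg m = n. const (Poly_Mapping.lookup P m) * monom m)"
    by (rule cpoly_eq_sum) (use assms in \<open>auto simp: homog_def\<close>)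
  then have "act (inv g) P = act (inv g) (\<Sum>m | mdeg m = n. const (Poly_Mapping.lookup P m) * monom m)"
    by (rule arg_cong)
  then have "act (inv g) P = (\<Sum>m | mdeg m = n. const (Poly_Mapping.lookup P m) * act (inv g) (monom m))"
    by (simp only: hom_sum[OF is_ring_hom_act] hom_mult[OF is_ring_hom_act] act_const)
  then have "Poly_Mapping.lookup (act (inv g) P) = (\<lambda>m.
      \<Sum>m' | mdeg m' = n. Poly_Mapping.lookup (act (inv g) (monom m')) m * Poly_Mapping.lookup P m')"
    by (simp add: fun_eq_iff lookup_sum lookup_const_mult mult.commute)
  then show ?thesis
    by (simp add: eval_at_def act_forms_def evaluate_substitute scale_def
        hom_sum[OF is_ring_hom_evaluate] hom_mult[OF is_ring_hom_evaluate])
qed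

lemma module_scale: "module (scale :: complex \<Rightarrow> 'v cpoly \<Rightarrow> _)"
  by unfold_locales (simp_all add: scale_def distrib_left hom_add[OF is_ring_hom_const]
      hom_mult[OF is_ring_hom_const] hom_1[OF is_ring_hom_const] distrib_right mult.assoc)

lemma orth_module_orbit_ideal: "orth_module CARD('n) (orbit_ideal d :: ('n::finite \<times> 'n) monomial cpoly set)"
  unfolding orth_module_def
proof (intro conjI ballI)
  show "module.subspace scale (orbit_ideal d :: ('n \<times> 'n) monomial cpoly set)"
    by (simp add: module.subspace_def[OF module_scale] orbit_ideal_def forms_on_0 forms_on_add forms_on_scale[unfolded scale_def]
        hom_0[OF is_ring_hom_eval_at] hom_add[OF is_ring_hom_eval_at] scale_def hom_mult[OF is_ring_hom_eval_at])
  show "act_forms CARD('n) g F \<in> orbit_ideal d"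
    if g: "g \<in> orth_group" and F: "F \<in> orbit_ideal d" for g and F :: "('n \<times> 'n) monomial cpoly"
  proof -
    have "eval_at (act_forms CARD('n) g F) (act h det_poly) = 0" if h: "h \<in> orth_group" for h
    proof -
      have "eval_at (act_forms CARD('n) g F) (act h det_poly) = eval_at F (act (inv g \<circ> h) det_poly)"
        using g h by (simp add: eval_at_act_forms homog_act homog_det_poly act_comp orth_group_inv)
      then show ?thesis
        using F orth_group_comp[OF orth_group_inv[OF g] h] by (simp add: orbit_ideal_def)
    qed
    then show ?thesis
      using F by (simp add: orbit_ideal_def act_forms_in_forms_on)
  qed
qed

text \<open>A coefficient of the Laplacian is a linear form in \<open>P\<close>. It vanishes on the
  orbit because the Laplacian commutes with orthogonal substitutions, and its \<open>d\<close>-th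
  power reaches the required degree.\<close>

lemma orbit_ideal_neq_0:
  assumes "CARD('n) \<ge> 2" "d > 0"
  shows "(orbit_ideal d :: ('n::finite \<times> 'n) monomial cpoly set) \<noteq> {0}"
proof -
  fix p :: "'n \<times> 'n"
  define e :: "nat \<Rightarrow> ('n \<times> 'n) monomial" where "e = Poly_Mapping.single p"
  define n where "n = CARD('n)"
  have n: "n \<ge> 2"
    using assms by (simp add: n_def)
  have "poly_map_on_forms n 1 (\<lambda>P :: ('n \<times> 'n) cpoly. trace (hessian P))"
    unfolding trace_def by (intro poly_map_on_forms_sum poly_map_on_forms_hessian)
  then obtain F where F: "F \<in> forms_on n 1"
    "\<And>P :: ('n \<times> 'n) cpoly. P \<in> homog n \<Longrightarrow> eval_at F P = Poly_Mapping.lookup (trace (hessian P)) (e (n - 2))"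
    unfolding poly_map_on_forms_def poly_on_forms_def by metis
  have "eval_at F (act g det_poly) = 0" if g: "g \<in> orth_group" for g
    using g by (simp add: F(2) n_def homog_act homog_det_poly trace_hessian_act trace_hessian_det_poly
        hom_0[OF is_ring_hom_act])
  then have "F ^ d \<in> orbit_ideal d"
    using assms(2) forms_on_power[OF F(1)]
    by (simp add: orbit_ideal_def n_def hom_power[OF is_ring_hom_eval_at])
  moreover have "eval_at F (monom (e n)) \<noteq> 0"
  proof -
    \<comment> \<open>The pure power of one variable is not harmonic: its Laplacian is
      \<open>n * (n - 1)\<close> times the power with exponent \<open>n - 2\<close>.\<close>
    let ?P = "monom (e n) :: ('n \<times> 'n) cpoly"
    have eq: "e (n - 2) + Poly_Mapping.single q 1 + Poly_Mapping.single q 1 = e n \<longleftrightarrow> q = p" for q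
    proof
      assume "e (n - 2) + Poly_Mapping.single q 1 + Poly_Mapping.single q 1 = e n"
      then have "Poly_Mapping.lookup (e (n - 2) + Poly_Mapping.single q 1 + Poly_Mapping.single q 1) q =
          Poly_Mapping.lookup (e n) q"
        by simp
      then show "q = p"
        by (auto simp: lookup_add e_def lookup_single when_def split: if_splits)
    next
      assume "q = p"
      then show "e (n - 2) + Poly_Mapping.single q 1 + Poly_Mapping.single q 1 = e n"
        unfolding e_def \<open>q = p\<close> Poly_Mapping.single_add[symmetric]
        by (intro arg_cong[where f = "Poly_Mapping.single p"]) (use n in simp)
    qed
    have "Poly_Mapping.lookup (partial q (partial q ?P)) (e (n - 2)) =
        (if q = p then of_nat (n - 1) * of_nat n else 0)" for q
      using n by (simp add: lookup_partial lookup_monom eq del: One_nat_def)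
        (auto simp: e_def lookup_add of_nat_diff)
    then have "Poly_Mapping.lookup (trace (hessian ?P)) (e (n - 2)) = of_nat (n - 1) * of_nat n"
      by (simp add: trace_def hessian_def lookup_sum)
    moreover have "?P \<in> homog n"
      using homog_monom[of "e n"] by (simp add: e_def)
    ultimately show ?thesis
      using n by (simp add: F(2))
  qed
  then have "F ^ d \<noteq> 0"
    by (metis hom_0 hom_power is_ring_hom_eval_at power_not_zero)
  ultimately show ?thesis
    by blast
qed

theorem theorem11p8:
  assumes "CARD('n::finite) \<ge> 2"
  shows "\<forall>j. odd j \<and> 1 < j \<and> j \<le> 2 * CARD('n) + 1 \<longrightarrow>
    (\<forall>P :: ('n \<times> 'n) cpoly.
       P \<in> homog CARD('n) \<and> P \<noteq> 0 \<and> proj_point P \<in> det_orbit_closure \<longrightarrow>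
       trace (exterior_power j (hessian P)) \<in> homog (j * (CARD('n) - 2)) \<and>
       P dvd trace (exterior_power j (hessian P))) \<and>
    (\<exists>M :: ('n \<times> 'n) monomial cpoly set.
       orth_module CARD('n) M \<and> M \<noteq> {0} \<and>
       M \<subseteq> forms_on CARD('n) ((j - 1) * (CARD('n) - 1)) \<and>
       (\<forall>F\<in>M. \<forall>P. P \<in> homog CARD('n) \<and> P \<noteq> 0 \<and> proj_point P \<in> det_orbit_closure \<longrightarrow>
          eval_at F P = 0))"
proof (intro allI impI conjI)
  fix j assume j: "odd j \<and> 1 < j \<and> j \<le> 2 * CARD('n) + 1"
  show "trace (exterior_power j (hessian P)) \<in> homog (j * (CARD('n) - 2))"
    and "P dvd trace (exterior_power j (hessian P))"
    if "P \<in> homog CARD('n) \<and> P \<noteq> 0 \<and> proj_point P \<in> det_orbit_closure" for P :: "('n \<times> 'n) cpoly"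
    using that j by (simp_all add: homog_trace_exterior_power homog_hessian dvd_trace_exterior_power_hessian)
  let ?M = "orbit_ideal ((j - 1) * (CARD('n) - 1)) :: ('n \<times> 'n) monomial cpoly set"
  \<comment> \<open>The degree is positive because \<open>j > 1\<close> and
    \<open>CARD('n) \<ge> 2\<close>.\<close>
  have "?M \<noteq> {0}"
    using assms j by (intro orbit_ideal_neq_0) auto
  moreover have "?M \<subseteq> forms_on CARD('n) ((j - 1) * (CARD('n) - 1))"
    by (auto simp: orbit_ideal_def)
  moreover have "eval_at F P = 0" if "F \<in> ?M" "proj_point P \<in> det_orbit_closure" for F P
    using vanishes_on_det_orbit_closure[OF _ _ that(2)] that(1) unfolding orbit_ideal_def by blast
  ultimately show "\<exists>M :: ('n \<times> 'n) monomial cpoly set.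
       orth_module CARD('n) M \<and> M \<noteq> {0} \<and>
       M \<subseteq> forms_on CARD('n) ((j - 1) * (CARD('n) - 1)) \<and>
       (\<forall>F\<in>M. \<forall>P. P \<in> homog CARD('n) \<and> P \<noteq> 0 \<and> proj_point P \<in> det_orbit_closure \<longrightarrow>
          eval_at F P = 0)"
    by (intro exI[of _ ?M]) (simp add: orth_module_orbit_ideal)
qed

end
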